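(* Let $H=\mathrm{Symp}(D)$, and let $\tau_0,\kappa\in C^1(H;\mathbb{R})$ be the $1$-cochains $$\tau_0(g)=\int_D g^*\eta\wedge(\eta-g^*\eta),\qquad \kappa(g)=\int_{\partial D}\mathcal{K}_{\eta,x_0}(g)\,\eta .$$ Set $\tau'=\tau_0+\kappa\in C^1(H;\mathbb{R})$. Then $$-\delta\tau'=\pi\, C_{\eta,x_0},$$ where $C_{\eta,x_0}$ is the ILM cocycle on $H$.
   Context: $D=\{(x,y)\in\mathbb{R}^2 \mid x^2+y^2\le 1\}$ has symplectic form $\omega = dx\wedge dy$ and standard orientation ($\partial D$ has the boundary orientation), $\eta=(x\,dy-y\,dx)/2$, so $d\eta=\omega$, and $x_0=(1,0)$. $H=\mathrm{Symp}(D)=\{g\in\mathrm{Diff}(D)\mid g^*\omega=\omega\}$. For $g\in H$, $\mathcal{K}_{\eta,x_0}(g):D\to\mathbb{R}$ is the unique smooth function with $d\mathcal{K}_{\eta,x_0}(g)=\eta-g^*\eta$ and $\mathcal{K}_{\eta,x_0}(g)(x_0)=0$. The ILM (Ismagilov–Losik–Michor) cocycle is $$C_{\eta,x_0}(g,h)=\int_{x_0}^{h(x_0)}(g^*\eta-\eta),\qquad g,h\in H,$$ the integral being along any path in $D$ from $x_0$ to $h(x_0)$. For a $1$-cochain $\tau:H\to\mathbb{R}$ (trivial coefficients), $\delta\tau(g,h)=\tau(h)-\tau(gh)+\tau(g)$. *)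

theory Defs
  imports "HOL-Analysis.Analysis"
begin

section \<open>Smooth maps on subsets of the plane\<close>

text \<open>\<open>Ck_on k U f\<close>: \<open>f\<close> is of class \<open>C\<^sup>k\<close> on the open set \<open>U\<close>.\<close>

primrec Ck_on :: "nat \<Rightarrow> (real^2) set \<Rightarrow> (real^2 \<Rightarrow> 'b::real_normed_vector) \<Rightarrow> bool" where
  "Ck_on 0 = (\<lambda>U f. continuous_on U f)"
| "Ck_on (Suc k) = (\<lambda>U f. f differentiable_on U \<and>
     (\<forall>v. Ck_on k U (\<lambda>p. frechet_derivative f (at p) v)))"

text \<open>Smoothness on a subset that need not be open, such as the closed disk, means smoothness
  up to the boundary: the map extends smoothly to an open neighbourhood.\<close>

definition smooth_on :: "(real^2) set \<Rightarrow> (real^2 \<Rightarrow> 'b::real_normed_vector) \<Rightarrow> bool" where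
  "smooth_on S f \<longleftrightarrow>
     (\<exists>U F. open U \<and> S \<subseteq> U \<and> (\<forall>k. Ck_on k U F) \<and> (\<forall>p\<in>S. F p = f p))"


section \<open>The disk and differential forms on it\<close>

definition disk :: "(real^2) set" where
  "disk = {p. (p$1)\<^sup>2 + (p$2)\<^sup>2 \<le> 1}"

text \<open>A one-form maps a point and a tangent vector to a real number, a two-form a point and
  two tangent vectors. Only the values at points of the disk matter.\<close>

type_synonym form1 = "real^2 \<Rightarrow> real^2 \<Rightarrow> real"
type_synonym form2 = "real^2 \<Rightarrow> real^2 \<Rightarrow> real^2 \<Rightarrow> real"

text \<open>The differential is taken within the disk, so that it depends only on the restriction of
  \<open>f\<close> to the disk. The disk has inward directions spanning the plane at each
  of its points, so the derivative within it is unique, on the boundary as well.\<close>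

definition diff_at :: "(real^2 \<Rightarrow> 'b::real_normed_vector) \<Rightarrow> real^2 \<Rightarrow> real^2 \<Rightarrow> 'b" where
  "diff_at f p = frechet_derivative f (at p within disk)"

definition pullback1 :: "(real^2 \<Rightarrow> real^2) \<Rightarrow> form1 \<Rightarrow> form1" where
  "pullback1 g \<alpha> = (\<lambda>p v. \<alpha> (g p) (diff_at g p v))"

definition pullback2 :: "(real^2 \<Rightarrow> real^2) \<Rightarrow> form2 \<Rightarrow> form2" where
  "pullback2 g \<sigma> = (\<lambda>p u v. \<sigma> (g p) (diff_at g p u) (diff_at g p v))"

definition wedge :: "form1 \<Rightarrow> form1 \<Rightarrow> form2" where
  "wedge \<alpha> \<beta> = (\<lambda>p u v. \<alpha> p u * \<beta> p v - \<alpha> p v * \<beta> p u)"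

definition form1_diff :: "form1 \<Rightarrow> form1 \<Rightarrow> form1" where
  "form1_diff \<alpha> \<beta> = (\<lambda>p v. \<alpha> p v - \<beta> p v)"

definition dx :: form1 where "dx = (\<lambda>p v. v$1)"

definition dy :: form1 where "dy = (\<lambda>p v. v$2)"

definition \<omega> :: form2 where "\<omega> = wedge dx dy"

definition \<eta> :: form1 where
  "\<eta> = (\<lambda>p v. (p$1 * dy p v - p$2 * dx p v) / 2)"

definition x\<^sub>0 :: "real^2" where "x\<^sub>0 = vector [1, 0]"

definition disk_integral :: "form2 \<Rightarrow> real" where
  "disk_integral \<sigma> = integral disk (\<lambda>p. \<sigma> p (axis 1 1) (axis 2 1))"

definition has_line_integral :: "form1 \<Rightarrow> (real \<Rightarrow> real^2) \<Rightarrow> real \<Rightarrow> bool" where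
  "has_line_integral \<alpha> \<gamma> c \<longleftrightarrow>
     ((\<lambda>t. \<alpha> (\<gamma> t) (vector_derivative \<gamma> (at t within {0..1}))) has_integral c) {0..1}"

definition line_integral :: "form1 \<Rightarrow> (real \<Rightarrow> real^2) \<Rightarrow> real" where
  "line_integral \<alpha> \<gamma> =
     integral {0..1} (\<lambda>t. \<alpha> (\<gamma> t) (vector_derivative \<gamma> (at t within {0..1})))"

definition disk_boundary :: "real \<Rightarrow> real^2" where
  "disk_boundary = (\<lambda>t. vector [cos (2 * pi * t), sin (2 * pi * t)])"


section \<open>Symplectomorphisms and cochains\<close>

text \<open>Elements of the diffeomorphism group are represented by functions that take the value
  \<open>undefined\<close> outside the disk, so that equality is equality of maps on the disk.
  The group multiplication is \<open>compose disk g h\<close>, i.e. \<open>g \<circ> h\<close> restricted to the disk.\<close>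

definition Diff_disk :: "(real^2 \<Rightarrow> real^2) set" where
  "Diff_disk = {g \<in> disk \<rightarrow>\<^sub>E disk. bij_betw g disk disk \<and>
     smooth_on disk g \<and> smooth_on disk (inv_into disk g)}"

definition Symp_disk :: "(real^2 \<Rightarrow> real^2) set" where
  "Symp_disk = {g \<in> Diff_disk. \<forall>p\<in>disk. pullback2 g \<omega> p = \<omega> p}"

text \<open>The membership in \<open>extensional disk\<close> expresses that \<open>\<K> \<alpha> x g\<close> is a
  function on the disk; without it the values elsewhere would not be determined.\<close>

definition \<K> :: "form1 \<Rightarrow> real^2 \<Rightarrow> (real^2 \<Rightarrow> real^2) \<Rightarrow> real^2 \<Rightarrow> real" where
  "\<K> \<alpha> x g = (THE K. K \<in> extensional disk \<and> smooth_on disk K \<and>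
     (\<forall>p\<in>disk. diff_at K p = form1_diff \<alpha> (pullback1 g \<alpha>) p) \<and> K x = 0)"

text \<open>The Ismagilov-Losik-Michor cocycle: the common value of the integrals along all
  piecewise \<open>C\<^sup>1\<close> paths in the disk from \<open>x\<close> to \<open>h x\<close>.\<close>

definition ILM :: "form1 \<Rightarrow> real^2 \<Rightarrow> (real^2 \<Rightarrow> real^2) \<Rightarrow> (real^2 \<Rightarrow> real^2) \<Rightarrow> real" where
  "ILM \<alpha> x g h = (THE c. \<forall>\<gamma>. valid_path \<gamma> \<and> path_image \<gamma> \<subseteq> disk \<and>
     pathstart \<gamma> = x \<and> pathfinish \<gamma> = h x \<longrightarrow>
     has_line_integral (form1_diff (pullback1 g \<alpha>) \<alpha>) \<gamma> c)"

definition coboundary ::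
    "((real^2 \<Rightarrow> real^2) \<Rightarrow> real) \<Rightarrow> (real^2 \<Rightarrow> real^2) \<Rightarrow> (real^2 \<Rightarrow> real^2) \<Rightarrow> real" where
  "coboundary \<tau> g h = \<tau> h - \<tau> (compose disk g h) + \<tau> g"

definition \<tau>\<^sub>0 :: "(real^2 \<Rightarrow> real^2) \<Rightarrow> real" where
  "\<tau>\<^sub>0 g = disk_integral (wedge (pullback1 g \<eta>) (form1_diff \<eta> (pullback1 g \<eta>)))"

definition \<kappa> :: "(real^2 \<Rightarrow> real^2) \<Rightarrow> real" where
  "\<kappa> g = line_integral (\<lambda>p v. \<K> \<eta> x\<^sub>0 g p * \<eta> p v) disk_boundary"

definition \<tau>' :: "(real^2 \<Rightarrow> real^2) \<Rightarrow> real" where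
  "\<tau>' g = \<tau>\<^sub>0 g + \<kappa> g"

end

theory Submission
  imports Defs
begin

text \<open>
  Let \<open>K\<close> be a primitive of \<open>\<eta> - g\<^sup>*\<eta>\<close>. Since \<open>dK \<and> dK = 0\<close>, the integrand of \<open>\<tau>\<^sub>0\<close> is
  \<open>\<eta> \<and> dK\<close>, while Stokes' theorem for \<open>K \<eta>\<close> gives
  \<open>\<kappa>(g) = \<integral> dK \<and> \<eta> + \<integral> K \<omega>\<close> once \<open>K\<close> vanishes at \<open>x\<^sub>0\<close>. The terms without \<open>\<omega>\<close> cancel, so
  \<open>\<tau>'(g)\<close> is just the integral of \<open>K\<close> over the disk. As \<open>K\<^sub>h + K\<^sub>g \<circ> h - K\<^sub>g (h x\<^sub>0)\<close> is
  the normalised primitive for \<open>g \<circ> h\<close>, and \<open>h\<close> preserves area, the defect of \<open>\<tau>'\<close>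
  is \<open>\<pi> K\<^sub>g (h x\<^sub>0)\<close>, which is \<open>- \<pi>\<close> times the cocycle.

  Stokes' theorem for \<open>K \<eta>\<close> is the divergence theorem for the radial field \<open>p K(p)\<close>, which in polar
  coordinates is the fundamental theorem of calculus applied to \<open>r\<^sup>2 K\<close> on each radius.
\<close>

section \<open>Calculus of maps of class \<open>C\<^sup>k\<close>\<close>

text \<open>On an open set the derivative at a point depends only on values in the set, so agreement
  passes to the derivatives in the induction.\<close>

lemma Ck_on_cong:
  fixes f g :: "real^2 \<Rightarrow> 'b::real_normed_vector"
  assumes "open U" "\<And>p. p \<in> U \<Longrightarrow> f p = g p"
  shows "Ck_on k U f \<longleftrightarrow> Ck_on k U g"
  using assms(2)
proof (induction k arbitrary: f g)
  case 0
  then have "continuous_on U f = continuous_on U g" by (rule continuous_on_cong[OF refl])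
  then show ?case by simp
next
  case (Suc k)
  have imp: "Ck_on (Suc k) U f2"
    if C: "Ck_on (Suc k) U f1" and eq: "\<And>p. p \<in> U \<Longrightarrow> f1 p = f2 p"
    for f1 f2 :: "real^2 \<Rightarrow> 'b"
  proof -
    have d: "f1 differentiable (at p)" if "p \<in> U" for p
      using conjunct1[OF C[unfolded Ck_on.simps(2)]] that \<open>open U\<close>
      by (simp add: differentiable_on_eq_differentiable_at)
    have fd: "frechet_derivative f1 (at p) = frechet_derivative f2 (at p)" if "p \<in> U" for p
      using d[OF that] \<open>open U\<close> that eq by (rule frechet_derivative_transform_within_open)
    have "f2 differentiable_on U"
      unfolding differentiable_on_def
    proof
      fix p assume p: "p \<in> U"
      show "f2 differentiable at p within U"
        by (rule differentiable_transform_within[where d=1, OF differentiable_at_withinI[OF d[OF p]]])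
          (use p eq in auto)
    qed
    moreover have "Ck_on k U (\<lambda>p. frechet_derivative f2 (at p) v)" for v
      using Suc.IH[of "\<lambda>p. frechet_derivative f1 (at p) v" "\<lambda>p. frechet_derivative f2 (at p) v"]
        C fd by simp
    ultimately show ?thesis by simp
  qed
  show ?case
  proof
    show "Ck_on (Suc k) U f \<Longrightarrow> Ck_on (Suc k) U g" by (erule imp) (rule Suc.prems)
    show "Ck_on (Suc k) U g \<Longrightarrow> Ck_on (Suc k) U f" by (erule imp) (rule Suc.prems[symmetric])
  qed
qed

lemma Ck_on_subset:
  "Ck_on k U f \<Longrightarrow> V \<subseteq> U \<Longrightarrow> Ck_on k V f"
proof (induction k arbitrary: f)
  case 0
  then show ?case by (auto intro: continuous_on_subset)
next
  case (Suc k)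
  then show ?case by (auto intro: differentiable_on_subset)
qed

lemma Ck_on_Suc_imp: "Ck_on (Suc k) U f \<Longrightarrow> Ck_on k U f"
proof (induction k arbitrary: f)
  case 0
  then show ?case by (simp add: differentiable_imp_continuous_on)
next
  case (Suc k)
  show ?case
    unfolding Ck_on.simps(2)[of k]
  proof (intro conjI allI)
    note C = Suc.prems[unfolded Ck_on.simps(2)[of "Suc k"]]
    show "f differentiable_on U" using C by (rule conjunct1)
    show "Ck_on k U (\<lambda>p. frechet_derivative f (at p) v)" for v
      by (rule Suc.IH) (rule C[THEN conjunct2, THEN spec])
  qed
qed

lemma Ck_on_mono: "j \<le> k \<Longrightarrow> Ck_on k U f \<Longrightarrow> Ck_on j U f"
  by (induction k rule: dec_induct) (blast intro: Ck_on_Suc_imp)+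

lemma Ck_on_has_derivative:
  assumes "Ck_on (Suc k) U f" "open U" "p \<in> U"
  shows "(f has_derivative frechet_derivative f (at p)) (at p)"
  using assms by (simp add: differentiable_on_eq_differentiable_at frechet_derivative_works)

lemma Ck_on_SucI:
  fixes f :: "real^2 \<Rightarrow> 'b::real_normed_vector"
  assumes "open U" "\<And>p. p \<in> U \<Longrightarrow> (f has_derivative D p) (at p)" "\<And>v. Ck_on k U (\<lambda>p. D p v)"
  shows "Ck_on (Suc k) U f"
proof -
  have fd: "frechet_derivative f (at p) = D p" if "p \<in> U" for p
    by (rule frechet_derivative_at[OF assms(2)[OF that], symmetric])
  have "Ck_on k U (\<lambda>p. frechet_derivative f (at p) v)" for v
    using Ck_on_cong[OF \<open>open U\<close>, of "\<lambda>p. frechet_derivative f (at p) v" "\<lambda>p. D p v" k] fd assms(3)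
    by simp
  moreover have "f differentiable_on U"
    using assms(1,2) by (auto simp: differentiable_on_eq_differentiable_at intro: differentiableI)
  ultimately show ?thesis by simp
qed

lemma Ck_on_const: "open U \<Longrightarrow> Ck_on k U (\<lambda>p. c)"
  by (induction k arbitrary: c) (auto simp: frechet_derivative_const)

lemma Ck_on_bounded_linear:
  assumes "bounded_linear L" "open U"
  shows "Ck_on k U L"
proof (cases k)
  case 0
  then show ?thesis using assms by (simp add: linear_continuous_on)
next
  case (Suc m)
  show ?thesis unfolding Suc
    by (rule Ck_on_SucI[where D="\<lambda>p. L"])
      (use assms in \<open>auto intro: bounded_linear_imp_has_derivative Ck_on_const\<close>)
qed

lemma Ck_on_add:
  assumes "open U" "Ck_on k U f" "Ck_on k U g"
  shows "Ck_on k U (\<lambda>p. f p + g p)"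
  using assms(2,3)
proof (induction k arbitrary: f g)
  case 0
  then show ?case unfolding Ck_on.simps by (intro continuous_intros)
next
  case (Suc k)
  show ?case
  proof (rule Ck_on_SucI[OF \<open>open U\<close>])
    show "((\<lambda>p. f p + g p) has_derivative
        (\<lambda>v. frechet_derivative f (at p) v + frechet_derivative g (at p) v)) (at p)" if "p \<in> U" for p
      using Suc.prems[THEN Ck_on_has_derivative, OF \<open>open U\<close> that] by (rule has_derivative_add)
    show "Ck_on k U (\<lambda>p. frechet_derivative f (at p) v + frechet_derivative g (at p) v)" for v
      using Suc.prems by (intro Suc.IH) simp_all
  qed
qed

lemma Ck_on_mult:
  fixes f g :: "real^2 \<Rightarrow> real"
  assumes "open U" "Ck_on k U f" "Ck_on k U g"
  shows "Ck_on k U (\<lambda>p. f p * g p)"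
  using assms(2,3)
proof (induction k arbitrary: f g)
  case 0
  then show ?case unfolding Ck_on.simps by (intro continuous_intros)
next
  case (Suc k)
  show ?case
  proof (rule Ck_on_SucI[OF \<open>open U\<close>])
    show "((\<lambda>p. f p * g p) has_derivative
        (\<lambda>v. f p * frechet_derivative g (at p) v + frechet_derivative f (at p) v * g p)) (at p)"
      if "p \<in> U" for p
      using Suc.prems[THEN Ck_on_has_derivative, OF \<open>open U\<close> that] by (rule has_derivative_mult)
    show "Ck_on k U (\<lambda>p. f p * frechet_derivative g (at p) v + frechet_derivative f (at p) v * g p)" for v
      using Suc.prems Suc.prems[THEN Ck_on_Suc_imp]
      by (intro Ck_on_add[OF \<open>open U\<close>] Suc.IH) simp_all
  qed
qed

lemma Ck_on_diff:
  fixes f g :: "real^2 \<Rightarrow> real"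
  assumes "open U" "Ck_on k U f" "Ck_on k U g"
  shows "Ck_on k U (\<lambda>p. f p - g p)"
  using Ck_on_add[OF assms(1,2) Ck_on_mult[OF assms(1) Ck_on_const[OF assms(1), of _ "-1"] assms(3)]]
  by simp

lemma Ck_on_linear_compose:
  assumes L: "bounded_linear L" and U: "open U" and "Ck_on k U f"
  shows "Ck_on k U (\<lambda>p. L (f p))"
  using assms(3)
proof (induction k arbitrary: f)
  case 0
  then show ?case using bounded_linear.continuous_on[OF L] by auto
next
  case (Suc k)
  show ?case
  proof (rule Ck_on_SucI[OF U])
    show "((\<lambda>p. L (f p)) has_derivative (\<lambda>v. L (frechet_derivative f (at p) v))) (at p)"
      if "p \<in> U" for p
      by (rule bounded_linear.has_derivative[OF L Ck_on_has_derivative[OF Suc.prems U that]])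
    show "Ck_on k U (\<lambda>p. L (frechet_derivative f (at p) v))" for v
      using Suc.prems by (intro Suc.IH) simp
  qed
qed

lemma vec2_eq: "(v::real^2) = v$1 *\<^sub>R axis 1 1 + v$2 *\<^sub>R axis 2 1"
  by (simp add: vec_eq_iff forall_2 axis_def)

lemma linear_vec2:
  fixes L :: "real^2 \<Rightarrow> 'b::real_normed_vector"
  assumes "linear L"
  shows "L v = v$1 *\<^sub>R L (axis 1 1) + v$2 *\<^sub>R L (axis 2 1)"
  by (subst vec2_eq[of v]) (simp only: linear_add[OF assms] linear_cmul[OF assms])

text \<open>In the chain rule the direction fed to the derivative of \<open>f\<close> varies with
  the point. Expanding it in the standard basis leaves products with fixed directions, to which the
  induction hypothesis applies.\<close>

lemma Ck_on_compose:
  fixes f :: "real^2 \<Rightarrow> real" and g :: "real^2 \<Rightarrow> real^2"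
  assumes "open U" "open V" "g ` U \<subseteq> V" "Ck_on k V f" "Ck_on k U g"
  shows "Ck_on k U (\<lambda>p. f (g p))"
  using assms(4,5)
proof (induction k arbitrary: f)
  case 0
  then show ?case using assms(3) by (auto intro: continuous_on_compose2)
next
  case (Suc k)
  let ?f = "\<lambda>q. frechet_derivative f (at q)" and ?g = "\<lambda>q. frechet_derivative g (at q)"
  have g: "Ck_on k U g" by (rule Ck_on_Suc_imp) fact
  show ?case
  proof (rule Ck_on_SucI[OF \<open>open U\<close>])
    fix p assume p: "p \<in> U"
    then have gp: "g p \<in> V" using assms(3) by auto
    have df: "(f has_derivative ?f (g p)) (at (g p))"
      by (rule Ck_on_has_derivative[OF Suc.prems(1) \<open>open V\<close> gp])
    have "((\<lambda>p. f (g p)) has_derivative (\<lambda>v. ?f (g p) (?g p v))) (at p)"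
      by (rule has_derivative_compose[OF Ck_on_has_derivative[OF Suc.prems(2) \<open>open U\<close> p] df])
    also have "(\<lambda>v. ?f (g p) (?g p v)) =
       (\<lambda>v. (?g p v)$1 * ?f (g p) (axis 1 1) + (?g p v)$2 * ?f (g p) (axis 2 1))"
      unfolding real_scaleR_def[symmetric] by (rule ext, rule linear_vec2[OF has_derivative_linear[OF df]])
    finally show "((\<lambda>p. f (g p)) has_derivative
       (\<lambda>v. (?g p v)$1 * ?f (g p) (axis 1 1) + (?g p v)$2 * ?f (g p) (axis 2 1))) (at p)" .
  next
    fix v
    have "Ck_on k U (\<lambda>p. ?f (g p) w)" for w
      by (rule Suc.IH[OF _ g]) (use Suc.prems(1) in simp)
    moreover have "Ck_on k U (\<lambda>p. ?g p v $ i)" for i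
      by (rule Ck_on_linear_compose[OF bounded_linear_vec_nth \<open>open U\<close>]) (use Suc.prems(2) in simp)
    ultimately show "Ck_on k U
        (\<lambda>p. (?g p v)$1 * ?f (g p) (axis 1 1) + (?g p v)$2 * ?f (g p) (axis 2 1))"
      by (intro Ck_on_add Ck_on_mult \<open>open U\<close>)
  qed
qed

section \<open>Integrals along rays from the origin\<close>

text \<open>The chain rule for dilation by \<open>t\<close> contributes one more factor
  \<open>t\<close>. Carrying the weight \<open>t^m\<close> makes this family of integrals closed
  under differentiation.\<close>

lemma leibniz_dilation:
  fixes a :: "real^2 \<Rightarrow> real"
  assumes C: "Ck_on (Suc 0) (ball 0 R) a" and p: "p \<in> ball 0 R"
  shows "((\<lambda>p. integral {0..1} (\<lambda>t. t^m * a (t *\<^sub>R p))) has_derivative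
     (\<lambda>v. integral {0..1} (\<lambda>t. t^Suc m * frechet_derivative a (at (t *\<^sub>R p)) v))) (at p)"
proof -
  let ?B = "ball (0::real^2) R"
  let ?D = "\<lambda>v p t. t^Suc m * frechet_derivative a (at (t *\<^sub>R p)) v"
  let ?e1 = "axis 1 1 :: real^2" and ?e2 = "axis 2 1 :: real^2"
  \<comment> \<open>\<open>leibniz_rule\<close> wants the derivative as a continuous function into
    bounded linear maps. Building it from the two coordinate functionals reduces its continuity to
    that of the partial derivatives.\<close>
  let ?fx = "\<lambda>x t. ?D ?e1 x t *\<^sub>R blinfun_inner_right ?e1 + ?D ?e2 x t *\<^sub>R blinfun_inner_right ?e2"
  have inB: "t *\<^sub>R x \<in> ?B" if "x \<in> ?B" "t \<in> {0..1}" for x t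
  proof -
    have "norm (t *\<^sub>R x) \<le> norm x" using that by (simp add: mult_left_le_one_le)
    with that show ?thesis by simp
  qed
  have D: "(a has_derivative frechet_derivative a (at q)) (at q)" if "q \<in> ?B" for q
    using Ck_on_has_derivative[OF C open_ball that] .
  have ca: "continuous_on ?B a" and cd: "continuous_on ?B (\<lambda>q. frechet_derivative a (at q) v)" for v
    using C Ck_on_Suc_imp[OF C] by simp_all
  have contD: "continuous_on (?B \<times> {0..1}) (\<lambda>(x,t). ?D v x t)" for v
    unfolding split_beta
    by (intro continuous_intros continuous_on_compose2[OF cd]) (use inB in auto)
  have cont: "continuous_on {0..1} (?D v p)" for v
    by (intro continuous_intros continuous_on_compose2[OF cd]) (use inB p in auto)
  have "((\<lambda>p. integral (cbox 0 1) (\<lambda>t. t^m * a (t *\<^sub>R p))) has_derivative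
     integral (cbox 0 1) (?fx p)) (at p within ?B)"
  proof (rule leibniz_rule)
    fix x t assume x: "x \<in> ?B" and t: "t \<in> cbox (0::real) 1"
    let ?F = "frechet_derivative a (at (t *\<^sub>R x))"
    have d: "(a has_derivative ?F) (at (t *\<^sub>R x))" using D inB x t by auto
    have l: "linear ?F" using d by (rule has_derivative_linear)
    have "((\<lambda>x. t^m * a (t *\<^sub>R x)) has_derivative (\<lambda>v. t^m * ?F (t *\<^sub>R v))) (at x within ?B)"
      by (rule has_derivative_mult_right[OF has_derivative_compose[where f="\<lambda>x. t *\<^sub>R x", OF _ d]])
        (intro derivative_intros)
    also have "(\<lambda>v. t^m * ?F (t *\<^sub>R v)) = blinfun_apply (?fx x t)"
    proof
      fix v
      show "t^m * ?F (t *\<^sub>R v) = blinfun_apply (?fx x t) v"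
        using linear_vec2[OF l, of v]
        by (simp add: linear_cmul[OF l] blinfun.add_left blinfun.scaleR_left inner_axis' algebra_simps)
    qed
    finally show "((\<lambda>x. t^m * a (t *\<^sub>R x)) has_derivative blinfun_apply (?fx x t)) (at x within ?B)" .
  next
    fix x assume x: "x \<in> ?B"
    show "(\<lambda>t. t^m * a (t *\<^sub>R x)) integrable_on cbox 0 1"
      by (intro integrable_continuous continuous_intros continuous_on_compose2[OF ca])
        (use inB x in auto)
  next
    show "continuous_on (?B \<times> cbox 0 1) (\<lambda>(x, t). ?fx x t)"
      using contD[of ?e1] contD[of ?e2] unfolding split_beta cbox_interval
      by (intro continuous_on_add continuous_on_scaleR continuous_on_const)
  qed (use p in auto)
  moreover have "blinfun_apply (integral (cbox 0 1) (?fx p)) = (\<lambda>v. integral {0..1} (?D v p))"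
  proof
    fix v
    have "continuous_on {0..1} (?fx p)" by (intro continuous_on_add continuous_on_scaleR continuous_on_const cont)
    then have i: "?fx p integrable_on {0..1}" by (rule integrable_continuous_real)
    have "blinfun_apply (integral {0..1} (?fx p)) v = integral {0..1} (\<lambda>t. blinfun_apply (?fx p t) v)"
      using integral_linear[OF i, of "\<lambda>b. blinfun_apply b v"] 
      by (simp add: o_def bounded_linear_intros)
    also have "\<dots> = integral {0..1} (?D v p)"
    proof (rule integral_cong)
      fix t :: real assume t: "t \<in> {0..1}"
      have "linear (frechet_derivative a (at (t *\<^sub>R p)))"
        using D inB p t has_derivative_linear by blast
      from linear_vec2[OF this, of v]
      show "blinfun_apply (?fx p t) v = ?D v p t"
        by (simp add: blinfun.add_left blinfun.scaleR_left inner_axis' algebra_simps)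
    qed
    finally show "blinfun_apply (integral (cbox 0 1) (?fx p)) v = integral {0..1} (?D v p)"
      by simp
  qed
  ultimately show ?thesis
    by (simp only: at_within_open[OF p open_ball] cbox_interval)
qed

text \<open>Each differentiation raises the exponent of the weight, so the induction leaves
  \<open>m\<close> free.\<close>

lemma Ck_on_integral_dilation:
  fixes a :: "real^2 \<Rightarrow> real"
  assumes "Ck_on k (ball 0 R) a"
  shows "Ck_on k (ball 0 R) (\<lambda>p. integral {0..1} (\<lambda>t. t^m * a (t *\<^sub>R p)))"
  using assms
proof (induction k arbitrary: a m)
  case 0
  let ?B = "ball (0::real^2) R"
  have inB: "t *\<^sub>R x \<in> ?B" if "x \<in> ?B" "t \<in> {0..1}" for x t
  proof -
    have "norm (t *\<^sub>R x) \<le> norm x" using that by (simp add: mult_left_le_one_le)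
    with that show ?thesis by simp
  qed
  have "continuous_on ?B (\<lambda>p. integral (cbox 0 1) (\<lambda>t. t^m * a (t *\<^sub>R p)))"
  proof (rule integral_continuous_on_param)
    show "continuous_on (?B \<times> cbox 0 1) (\<lambda>(p, t). t^m * a (t *\<^sub>R p))"
      unfolding split_beta
    proof (rule continuous_on_mult)
      have a: "continuous_on ?B a" using 0 by simp
      have "(\<lambda>x. snd x *\<^sub>R fst x) ` (?B \<times> cbox 0 1) \<subseteq> ?B" using inB by (auto simp: cbox_interval)
      then show "continuous_on (?B \<times> cbox 0 1) (\<lambda>x. a (snd x *\<^sub>R fst x))"
        by (rule continuous_on_compose2[OF a, rotated]) (intro continuous_intros)
    qed (intro continuous_intros)
  qed
  then show ?case by (simp add: cbox_interval)
next
  case (Suc k)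
  have 1: "Ck_on (Suc 0) (ball 0 R) a"
    by (rule Ck_on_mono[OF _ Suc.prems]) simp
  show ?case
  proof (rule Ck_on_SucI[OF open_ball leibniz_dilation[OF 1]])
    show "Ck_on k (ball 0 R)
        (\<lambda>p. integral {0..1} (\<lambda>t. t ^ Suc m * frechet_derivative a (at (t *\<^sub>R p)) v))" for v
      by (rule Suc.IH) (use Suc.prems in simp)
  qed
qed

section \<open>Operations on smooth functions\<close>

lemma smooth_on_cong: "smooth_on S f \<Longrightarrow> (\<And>p. p \<in> S \<Longrightarrow> f p = g p) \<Longrightarrow> smooth_on S g"
  unfolding smooth_on_def by metis

lemma smooth_on_add:
  fixes f g :: "real^2 \<Rightarrow> 'b::real_normed_vector"
  assumes "smooth_on S f" "smooth_on S g"
  shows "smooth_on S (\<lambda>p. f p + g p)"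
proof -
  obtain U F V G where U: "open U" "S \<subseteq> U" "\<And>k. Ck_on k U F" "\<And>p. p \<in> S \<Longrightarrow> F p = f p"
    and V: "open V" "S \<subseteq> V" "\<And>k. Ck_on k V G" "\<And>p. p \<in> S \<Longrightarrow> G p = g p"
    using assms unfolding smooth_on_def by blast
  have "Ck_on k (U \<inter> V) (\<lambda>p. F p + G p)" for k
    by (rule Ck_on_add[OF open_Int[OF U(1) V(1)] Ck_on_subset[OF U(3)] Ck_on_subset[OF V(3)]]) auto
  with U V show ?thesis
    unfolding smooth_on_def by (intro exI[of _ "U \<inter> V"] exI[of _ "\<lambda>p. F p + G p"]) auto
qed

lemma smooth_on_const: "smooth_on S (\<lambda>p. c)"
  unfolding smooth_on_def using Ck_on_const[OF open_UNIV] by blast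

lemma smooth_on_compose:
  fixes f :: "real^2 \<Rightarrow> real" and h :: "real^2 \<Rightarrow> real^2"
  assumes "smooth_on T f" "smooth_on S h" "h ` S \<subseteq> T"
  shows "smooth_on S (\<lambda>p. f (h p))"
proof -
  obtain U F V H where U: "open U" "T \<subseteq> U" "\<And>k. Ck_on k U F" "\<And>p. p \<in> T \<Longrightarrow> F p = f p"
    and V: "open V" "S \<subseteq> V" "\<And>k. Ck_on k V H" "\<And>p. p \<in> S \<Longrightarrow> H p = h p"
    using assms(1,2) unfolding smooth_on_def by blast
  \<comment> \<open>Away from \<open>S\<close> the extension \<open>H\<close> may leave the domain
    \<open>U\<close> of \<open>F\<close>; the preimage avoids this and is still an open
    neighbourhood of \<open>S\<close>.\<close>
  let ?W = "V \<inter> H -` U"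
  have W: "open ?W"
    using V(3)[of 0] V(1) U(1) by (simp add: continuous_open_preimage)
  have "Ck_on k ?W (\<lambda>p. F (H p))" for k
    by (rule Ck_on_compose[OF W U(1) _ U(3) Ck_on_subset[OF V(3)]]) auto
  moreover have "S \<subseteq> ?W" using assms(3) U V by fastforce
  moreover have "F (H p) = f (h p)" if "p \<in> S" for p
    using U(4)[of "h p"] V(4)[OF that] assms(3) that by auto
  ultimately show ?thesis
    unfolding smooth_on_def using W by (intro exI[of _ ?W] exI[of _ "\<lambda>p. F (H p)"]) auto
qed

section \<open>Symmetry of second derivatives\<close>

lemma DERIV_along_line:
  fixes f :: "'a::real_normed_vector \<Rightarrow> real"
  assumes "(f has_derivative F) (at (q + s *\<^sub>R u))"
  shows "((\<lambda>s. f (q + s *\<^sub>R u)) has_field_derivative F u) (at s)"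
proof -
  have "((\<lambda>s. f (q + s *\<^sub>R u)) has_derivative (\<lambda>d. F (d *\<^sub>R u))) (at s)"
    by (rule has_derivative_compose[where f="\<lambda>s. q + s *\<^sub>R u", OF _ assms])
      (auto intro!: derivative_eq_intros)
  moreover have "(\<lambda>d. F (d *\<^sub>R u)) = (*) (F u)"
    using linear_cmul[OF has_derivative_linear[OF assms]] by (auto simp: mult.commute)
  ultimately show ?thesis by (simp add: has_field_derivative_def)
qed

text \<open>The mean value theorem is applied twice to the increment over a parallelogram: in
  direction \<open>u\<close>, to the difference of \<open>f\<close> along two parallel sides, then
  in direction \<open>v\<close>, to the derivative along \<open>u\<close>.\<close>

lemma second_difference:
  fixes f :: "real^2 \<Rightarrow> real"
  assumes C: "Ck_on (Suc (Suc 0)) U f" and U: "open U" and "h > 0"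
    and sub: "\<And>s t. 0 \<le> s \<Longrightarrow> s \<le> h \<Longrightarrow> 0 \<le> t \<Longrightarrow> t \<le> h \<Longrightarrow> p + s *\<^sub>R u + t *\<^sub>R v \<in> U"
  shows "\<exists>s t. 0 \<le> s \<and> s \<le> h \<and> 0 \<le> t \<and> t \<le> h \<and>
    f (p + h *\<^sub>R u + h *\<^sub>R v) - f (p + h *\<^sub>R u) - f (p + h *\<^sub>R v) + f p =
    h * h * frechet_derivative (\<lambda>q. frechet_derivative f (at q) u) (at (p + s *\<^sub>R u + t *\<^sub>R v)) v"
proof -
  let ?F = "\<lambda>q. frechet_derivative f (at q) u"
  have C1: "Ck_on (Suc 0) U ?F" using C by simp
  have d: "((\<lambda>s. f (w + p + s *\<^sub>R u)) has_field_derivative ?F (w + p + s *\<^sub>R u)) (at s)"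
    if "w + p + s *\<^sub>R u \<in> U" for w s
    by (rule DERIV_along_line[OF Ck_on_has_derivative[OF C U that]])
  have sub1: "h *\<^sub>R v + p + s *\<^sub>R u \<in> U" "0 + p + s *\<^sub>R u \<in> U" if "0 \<le> s" "s \<le> h" for s
    using sub[of s h] sub[of s 0] that \<open>h > 0\<close> by (simp_all add: algebra_simps)
  have "\<exists>s>0. s < h \<and> (f (h *\<^sub>R v + p + h *\<^sub>R u) - f (0 + p + h *\<^sub>R u)) - (f (h *\<^sub>R v + p + 0 *\<^sub>R u) - f (0 + p + 0 *\<^sub>R u))
    = (h - 0) * (?F (h *\<^sub>R v + p + s *\<^sub>R u) - ?F (0 + p + s *\<^sub>R u))"
    by (rule MVT2[OF \<open>h > 0\<close>]) (intro DERIV_diff d sub1)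
  then obtain s where s: "0 < s" "s < h" and
    e1: "(f (h *\<^sub>R v + p + h *\<^sub>R u) - f (p + h *\<^sub>R u)) - (f (h *\<^sub>R v + p) - f p)
      = h * (?F (h *\<^sub>R v + p + s *\<^sub>R u) - ?F (p + s *\<^sub>R u))" by auto
  have "\<exists>t>0. t < h \<and> ?F (p + s *\<^sub>R u + h *\<^sub>R v) - ?F (p + s *\<^sub>R u + 0 *\<^sub>R v)
     = (h - 0) * frechet_derivative ?F (at (p + s *\<^sub>R u + t *\<^sub>R v)) v"
    by (rule MVT2[OF \<open>h > 0\<close>], rule DERIV_along_line, rule Ck_on_has_derivative[OF C1 U])
      (use sub s in auto)
  then obtain t where t: "0 < t" "t < h" and
    e2: "?F (p + s *\<^sub>R u + h *\<^sub>R v) - ?F (p + s *\<^sub>R u)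
     = h * frechet_derivative ?F (at (p + s *\<^sub>R u + t *\<^sub>R v)) v" by auto
  have "f (p + h *\<^sub>R u + h *\<^sub>R v) - f (p + h *\<^sub>R u) - f (p + h *\<^sub>R v) + f p =
    h * (?F (p + s *\<^sub>R u + h *\<^sub>R v) - ?F (p + s *\<^sub>R u))"
    using e1 by (simp add: add_ac)
  with e2 s t show ?thesis by (intro exI[of _ s] exI[of _ t]) (auto simp: mult.assoc)
qed

text \<open>The parallelogram increment is the same in either order of \<open>u\<close> and
  \<open>v\<close>, so the two mixed derivatives take a common value at two points near
  \<open>p\<close>. Continuity carries this to \<open>p\<close> up to an arbitrary
  \<open>e\<close>.\<close>

lemma mixed_partials_commute:
  fixes f :: "real^2 \<Rightarrow> real"
  assumes C: "Ck_on (Suc (Suc 0)) U f" and U: "open U" and p: "p \<in> U"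
  shows "frechet_derivative (\<lambda>q. frechet_derivative f (at q) u) (at p) v =
    frechet_derivative (\<lambda>q. frechet_derivative f (at q) v) (at p) u"
proof (rule dense_eq0_I[THEN eq_iff_diff_eq_0[THEN iffD2]])
  let ?A = "\<lambda>u v p. frechet_derivative (\<lambda>q. frechet_derivative f (at q) u) (at p) v"
  fix e :: real assume "e > 0"
  have cont: "isCont (?A u v) p" for u v
    using C U p by (simp add: continuous_on_eq_continuous_at)
  have "\<exists>d>0. \<forall>x. dist x p < d \<longrightarrow> dist (?A u v x) (?A u v p) < e/2" for u v
    using cont[of u v, unfolded continuous_at_eps_delta, rule_format, of "e/2"] \<open>e > 0\<close>
    by (simp add: dist_norm)
  then obtain d1 d2 where d1: "d1 > 0" "\<And>x. dist x p < d1 \<Longrightarrow> dist (?A u v x) (?A u v p) < e/2"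
    and d2: "d2 > 0" "\<And>x. dist x p < d2 \<Longrightarrow> dist (?A v u x) (?A v u p) < e/2" by meson
  obtain d3 where d3: "d3 > 0" "ball p d3 \<subseteq> U" using U p open_contains_ball by blast
  define d where "d = min d1 (min d2 d3)"
  have "d > 0" using d1 d2 d3 by (simp add: d_def)
  \<comment> \<open>This scale keeps the whole parallelogram within distance \<open>d\<close> of
    \<open>p\<close>; the summand 1 covers vanishing \<open>u\<close> and \<open>v\<close> and makes
    the bound strict.\<close>
  define h where "h = d / (1 + norm u + norm v)"
  have pos: "1 + norm u + norm v > 0" by (simp add: add_pos_nonneg)
  then have "h > 0" using \<open>d > 0\<close> by (simp add: h_def)
  have near: "dist (p + s *\<^sub>R u + t *\<^sub>R v) p < d" if "0 \<le> s" "s \<le> h" "0 \<le> t" "t \<le> h" for s t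
  proof -
    have "dist (p + s *\<^sub>R u + t *\<^sub>R v) p = norm (s *\<^sub>R u + t *\<^sub>R v)" by (simp add: dist_norm)
    also have "\<dots> \<le> s * norm u + t * norm v"
      using norm_triangle_ineq[of "s *\<^sub>R u" "t *\<^sub>R v"] that by simp
    also have "\<dots> \<le> h * norm u + h * norm v" using that by (intro add_mono mult_right_mono) auto
    also have "\<dots> < h * (1 + norm u + norm v)" using \<open>h > 0\<close> by (simp add: algebra_simps)
    also have "\<dots> = d" using pos by (simp add: h_def)
    finally show ?thesis .
  qed
  have sub: "p + s *\<^sub>R u + t *\<^sub>R v \<in> U" if "0 \<le> s" "s \<le> h" "0 \<le> t" "t \<le> h" for s t
    using near[OF that] d3 by (auto simp: d_def dist_commute)
  then have sub': "p + s *\<^sub>R v + t *\<^sub>R u \<in> U" if "0 \<le> s" "s \<le> h" "0 \<le> t" "t \<le> h" for s t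
    using sub[of t s] that by (simp add: add_ac)
  obtain s t where st: "0 \<le> s" "s \<le> h" "0 \<le> t" "t \<le> h"
    "f (p + h *\<^sub>R u + h *\<^sub>R v) - f (p + h *\<^sub>R u) - f (p + h *\<^sub>R v) + f p =
      h * h * ?A u v (p + s *\<^sub>R u + t *\<^sub>R v)"
    using second_difference[OF C U \<open>h > 0\<close> sub] by blast
  obtain s' t' where st': "0 \<le> s'" "s' \<le> h" "0 \<le> t'" "t' \<le> h"
    "f (p + h *\<^sub>R v + h *\<^sub>R u) - f (p + h *\<^sub>R v) - f (p + h *\<^sub>R u) + f p =
      h * h * ?A v u (p + s' *\<^sub>R v + t' *\<^sub>R u)"
    using second_difference[OF C U \<open>h > 0\<close> sub'] by blast
  have "h * h * ?A u v (p + s *\<^sub>R u + t *\<^sub>R v) = h * h * ?A v u (p + s' *\<^sub>R v + t' *\<^sub>R u)"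
    using st(5) st'(5)[unfolded add.assoc[of p] add.commute[of "h *\<^sub>R v"], folded add.assoc] by linarith
  then have eq: "?A u v (p + s *\<^sub>R u + t *\<^sub>R v) = ?A v u (p + s' *\<^sub>R v + t' *\<^sub>R u)"
    using \<open>h > 0\<close> by simp
  have "dist (?A u v (p + s *\<^sub>R u + t *\<^sub>R v)) (?A u v p) < e/2"
    using near[OF st(1-4)] by (intro d1) (simp add: d_def)
  moreover have "dist (?A v u (p + s' *\<^sub>R v + t' *\<^sub>R u)) (?A v u p) < e/2"
    using near[OF st'(3,4,1,2)] by (intro d2) (simp add: d_def add_ac)
  ultimately show "\<bar>?A u v p - ?A v u p\<bar> \<le> e"
    unfolding eq dist_real_def by linarith
qed

section \<open>Derivatives within the disk\<close>

lemma disk_eq_cball: "disk = cball 0 1"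
proof -
  have "p \<in> disk \<longleftrightarrow> p \<in> cball 0 1" for p
    by (simp add: disk_def norm_eq_sqrt_inner inner_vec_def sum_2 power2_eq_square)
  then show ?thesis by blast
qed

lemma convex_disk: "convex disk" and compact_disk: "compact disk"
  by (auto simp: disk_eq_cball)

text \<open>The library's uniqueness theorem asks for nearby points of the set in every coordinate
  direction, which fails at boundary points of the disk such as \<open>x\<^sub>0\<close>.\<close>

lemma has_derivative_unique_within_disk:
  fixes f :: "real^2 \<Rightarrow> 'b::real_normed_vector"
  assumes "(f has_derivative A) (at p within disk)" "(f has_derivative B) (at p within disk)"
    and p: "p \<in> disk"
  shows "A = B"
proof -
  let ?L = "\<lambda>v. A v - B v"
  have L: "linear ?L"
    using assms(1,2) by (intro linear_compose_sub has_derivative_linear)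
  have 0: "((\<lambda>_. 0) has_derivative ?L) (at p within disk)"
    using has_derivative_diff[OF assms(1,2)] by simp
  \<comment> \<open>Along the chord from \<open>p\<close> to \<open>q\<close> the zero function has
    derivative \<open>?L (q - p)\<close> at the left end, and one-sided derivatives on an interval
    are unique.\<close>
  have chord: "?L (q - p) = 0" if q: "q \<in> disk" for q
  proof -
    let ?c = "\<lambda>t::real. p + t *\<^sub>R (q - p)"
    have sub: "?c ` {0..1} \<subseteq> disk"
    proof safe
      fix t :: real assume "t \<in> {0..1}"
      then have "(1 - t) *\<^sub>R p + t *\<^sub>R q \<in> disk"
        using convexD[OF convex_disk p q, of "1 - t" t] by simp
      then show "?c t \<in> disk" by (simp add: algebra_simps)
    qed
    have "(?c has_derivative (\<lambda>t. t *\<^sub>R (q - p))) (at 0 within {0..1})"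
      by (auto intro!: derivative_eq_intros)
    from has_derivative_in_compose[OF this, of "\<lambda>_. 0" ?L] has_derivative_subset[OF 0 sub]
    have "((\<lambda>_. 0) has_derivative (\<lambda>t. ?L (t *\<^sub>R (q - p)))) (at (0::real) within {0..1})"
      by simp
    then have "((\<lambda>_::real. 0) has_vector_derivative ?L (q - p)) (at 0 within {0..1})"
      unfolding has_vector_derivative_def by (simp only: linear_cmul[OF L])
    moreover have "((\<lambda>_::real. 0) has_vector_derivative 0) (at 0 within {0..1})"
      by (rule has_vector_derivative_const)
    ultimately show ?thesis
      by (rule vector_derivative_unique_within[rotated]) (simp add: at_within_Icc_at_right)
  qed
  \<comment> \<open>A small multiple of \<open>v\<close> and the origin both lie in the disk; the
    difference of the chords from \<open>p\<close> to them is that multiple of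
    \<open>v\<close>.\<close>
  have "?L v = 0" for v
  proof -
    define c where "c = 1 / (1 + norm v)"
    have c: "c > 0" by (simp add: c_def add_pos_nonneg)
    have "norm (c *\<^sub>R v) \<le> 1" by (simp add: c_def add_pos_nonneg field_simps)
    then have "?L (c *\<^sub>R v - p) = 0" by (intro chord) (simp add: disk_eq_cball)
    moreover have "?L (0 - p) = 0" by (intro chord) (simp add: disk_eq_cball)
    ultimately have "?L (c *\<^sub>R v) = 0"
      using linear_diff[OF L, of "c *\<^sub>R v - p" "0 - p"] by simp
    with c show ?thesis using linear_cmul[OF L, of c v] by simp
  qed
  then show ?thesis by (auto simp: fun_eq_iff)
qed

lemma diff_at_eqI:
  assumes "(f has_derivative A) (at p within disk)" "p \<in> disk"
  shows "diff_at f p = A"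
proof -
  have "(f has_derivative diff_at f p) (at p within disk)"
    using assms(1) unfolding diff_at_def by (metis differentiableI frechet_derivative_works)
  from has_derivative_unique_within_disk[OF this assms] show ?thesis .
qed

text \<open>Compactness of the disk shrinks the neighbourhood to a concentric ball of radius above
  1, which is closed under the dilations in the radial integrals. The extension computes
  \<open>diff_at\<close> on the boundary too.\<close>

lemma smooth_on_diskE:
  fixes f :: "real^2 \<Rightarrow> 'b::real_normed_vector"
  assumes "smooth_on disk f"
  obtains R F where "R > 1" "\<And>k. Ck_on k (ball 0 R) F" "\<And>p. p \<in> disk \<Longrightarrow> F p = f p"
    "\<And>p. p \<in> disk \<Longrightarrow> (f has_derivative frechet_derivative F (at p)) (at p within disk)"
    "\<And>p. p \<in> disk \<Longrightarrow> diff_at f p = frechet_derivative F (at p)"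
proof -
  obtain U F where U: "open U" "disk \<subseteq> U" and C: "\<And>k. Ck_on k U F" and eq: "\<And>p. p \<in> disk \<Longrightarrow> F p = f p"
    using assms unfolding smooth_on_def by blast
  obtain e where e: "e > 0" "{x. infdist x disk \<le> e} \<subseteq> U"
  proof (rule compact_in_open_separated[OF _ compact_disk U])
    show "disk \<noteq> {}" by (simp add: disk_eq_cball)
  qed
  have "ball 0 (1 + e) \<subseteq> U"
  proof
    fix x :: "real^2" assume x: "x \<in> ball 0 (1 + e)"
    show "x \<in> U"
    proof (cases "norm x \<le> 1")
      case True
      then show ?thesis using U by (auto simp: disk_eq_cball)
    next
      case False
      then have "x \<noteq> 0" by auto
      then have "x /\<^sub>R norm x \<in> disk" by (simp add: disk_eq_cball)
      then have "infdist x disk \<le> dist x (x /\<^sub>R norm x)" by (rule infdist_le)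
      also have "x - x /\<^sub>R norm x = (1 - 1 / norm x) *\<^sub>R x"
        by (simp add: algebra_simps divide_inverse)
      then have "dist x (x /\<^sub>R norm x) = norm ((1 - 1 / norm x) *\<^sub>R x)" by (simp only: dist_norm)
      also have "\<dots> = \<bar>1 - 1 / norm x\<bar> * norm x" by simp
      also have "\<bar>1 - 1 / norm x\<bar> = 1 - 1 / norm x"
        using False by (intro abs_of_nonneg) (simp add: divide_le_eq_1)
      also have "(1 - 1 / norm x) * norm x = norm x - 1"
        using \<open>x \<noteq> 0\<close> by (simp add: left_diff_distrib)
      finally show ?thesis using e x by auto
    qed
  qed
  then have CB: "Ck_on k (ball 0 (1+e)) F" for k using C by (rule Ck_on_subset[rotated])
  have d: "(f has_derivative frechet_derivative F (at p)) (at p within disk)" if p: "p \<in> disk" for p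
  proof -
    have "(F has_derivative frechet_derivative F (at p)) (at p within disk)"
      by (rule has_derivative_at_withinI[OF Ck_on_has_derivative[OF C U(1)]]) (use U p in auto)
    then show ?thesis by (rule has_derivative_transform[OF p, rotated]) (simp add: eq)
  qed
  show ?thesis
    by (rule that[of "1+e" F]) (use e CB eq d diff_at_eqI[OF d] in auto)
qed

lemma smooth_on_disk_has_derivative:
  assumes "smooth_on disk f" "p \<in> disk"
  shows "(f has_derivative diff_at f p) (at p within disk)"
  using assms by (metis smooth_on_diskE)

lemma smooth_on_disk_continuous_on_diff_at:
  assumes "smooth_on disk f"
  shows "continuous_on disk (\<lambda>p. diff_at f p v)"
proof -
  obtain R F where R: "R > 1" and F: "\<And>k. Ck_on k (ball 0 R) F"
    and d: "\<And>p. p \<in> disk \<Longrightarrow> diff_at f p = frechet_derivative F (at p)"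
    using smooth_on_diskE[OF assms] by metis
  have "continuous_on (ball 0 R) (\<lambda>p. frechet_derivative F (at p) v)"
    using F[of "Suc 0"] by simp
  moreover have "disk \<subseteq> ball 0 R" using R by (auto simp: disk_eq_cball)
  ultimately have "continuous_on disk (\<lambda>p. frechet_derivative F (at p) v)"
    by (rule continuous_on_subset)
  then show ?thesis by (rule continuous_on_eq) (simp add: d)
qed

lemma smooth_on_disk_continuous: "smooth_on disk f \<Longrightarrow> continuous_on disk f"
  using smooth_on_disk_has_derivative has_derivative_continuous_on by blast

section \<open>Primitives\<close>

text \<open>The form is closed only on the disk, but its radial primitive is defined on the whole ball
  and hence smooth up to the boundary of the disk.\<close>

lemma poincare_on_disk:
  fixes a :: "real^2 \<Rightarrow> real^2 \<Rightarrow> real"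
  assumes R: "R > 1" and C: "\<And>k v. Ck_on k (ball 0 R) (\<lambda>q. a q v)" and lin: "\<And>q. q \<in> ball 0 R \<Longrightarrow> linear (a q)"
    and closed: "\<And>q u v. q \<in> disk \<Longrightarrow>
      frechet_derivative (\<lambda>q. a q v) (at q) u = frechet_derivative (\<lambda>q. a q u) (at q) v"
  obtains F where "\<And>k. Ck_on k (ball 0 R) F" "\<And>p. p \<in> disk \<Longrightarrow> (F has_derivative a p) (at p)"
proof -
  let ?B = "ball (0::real^2) R"
  let ?D = "\<lambda>v q. frechet_derivative (\<lambda>q. a q v) (at q)"
  \<comment> \<open>\<open>F p\<close> is the integral of the form along the segment from the origin
    to \<open>p\<close>, written in coordinates; \<open>E v p\<close> is the derivative of
    \<open>A v\<close> at \<open>p\<close>.\<close>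
  define A where "A v p = integral {0..1} (\<lambda>t. t ^ 0 * a (t *\<^sub>R p) v)" for v p
  define E where "E v p u = integral {0..1} (\<lambda>t. t ^ Suc 0 * ?D v (t *\<^sub>R p) u)" for v p u
  define F where "F p = p$1 * A (axis 1 1) p + p$2 * A (axis 2 1) p" for p
  have CF: "Ck_on k ?B F" for k
    unfolding F_def A_def
    by (intro Ck_on_add Ck_on_mult Ck_on_integral_dilation C open_ball Ck_on_bounded_linear
        bounded_linear_vec_nth)
  have "(F has_derivative a p) (at p)" if p: "p \<in> disk" for p
  proof -
    have pB: "p \<in> ?B" using p R by (auto simp: disk_eq_cball)
    have tp: "t *\<^sub>R p \<in> disk" if "t \<in> {0..1}" for t
      using p that by (auto simp: disk_eq_cball abs_mult intro: mult_le_one)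
    then have tpB: "(\<lambda>t. t *\<^sub>R p) ` {0..1} \<subseteq> ?B" using R by (force simp: disk_eq_cball)
    have ca: "continuous_on {0..1} (\<lambda>t. a (t *\<^sub>R p) v)" for v
      by (rule continuous_on_compose2[OF _ _ tpB]) (use C[of 0 v] in \<open>auto intro!: continuous_intros\<close>)
    have cD: "continuous_on {0..1} (\<lambda>t. ?D v (t *\<^sub>R p) u)" for u v
      by (rule continuous_on_compose2[OF _ _ tpB, where g="\<lambda>q. ?D v q u"])
        (use C[of "Suc 0" v] in \<open>auto intro!: continuous_intros\<close>)
    have dA: "(A v has_derivative E v p) (at p)" for v
      unfolding A_def E_def by (rule leibniz_dilation[OF C pB])
    have dF: "(F has_derivative (\<lambda>v. (p$1 * E (axis 1 1) p v + v$1 * A (axis 1 1) p) +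
        (p$2 * E (axis 2 1) p v + v$2 * A (axis 2 1) p))) (at p)"
      unfolding F_def
      by (intro has_derivative_add has_derivative_mult dA bounded_linear_imp_has_derivative
          bounded_linear_vec_nth)
    have "(p$1 * E (axis 1 1) p v + v$1 * A (axis 1 1) p) +
        (p$2 * E (axis 2 1) p v + v$2 * A (axis 2 1) p) = a p v" for v
    proof -
      have iA: "((\<lambda>t. t ^ 0 * a (t *\<^sub>R p) w) has_integral A w p) {0..1}" for w
        unfolding A_def by (intro integrable_integral integrable_continuous_real continuous_on_mult
            continuous_intros ca)
      have iE: "((\<lambda>t. t ^ Suc 0 * ?D w (t *\<^sub>R p) u) has_integral E w p u) {0..1}" for w u
        unfolding E_def by (intro integrable_integral integrable_continuous_real continuous_on_mult
            continuous_intros cD)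
      have 1: "((\<lambda>t. (p$1 * (t ^ Suc 0 * ?D (axis 1 1) (t *\<^sub>R p) v) + v$1 * (t ^ 0 * a (t *\<^sub>R p) (axis 1 1))) +
         (p$2 * (t ^ Suc 0 * ?D (axis 2 1) (t *\<^sub>R p) v) + v$2 * (t ^ 0 * a (t *\<^sub>R p) (axis 2 1)))) has_integral
        (p$1 * E (axis 1 1) p v + v$1 * A (axis 1 1) p) +
        (p$2 * E (axis 2 1) p v + v$2 * A (axis 2 1) p)) {0..1}"
        by (intro has_integral_add has_integral_mult_right iA iE)
      \<comment> \<open>Closedness moves \<open>v\<close> from the direction of differentiation into
        the argument of the form, so the derivative terms combine into one along the ray. It is
        applied only at points \<open>t *\<^sub>R p\<close> of the disk.\<close>
      have 2: "(p$1 * (t ^ Suc 0 * ?D (axis 1 1) (t *\<^sub>R p) v) + v$1 * (t ^ 0 * a (t *\<^sub>R p) (axis 1 1))) +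
         (p$2 * (t ^ Suc 0 * ?D (axis 2 1) (t *\<^sub>R p) v) + v$2 * (t ^ 0 * a (t *\<^sub>R p) (axis 2 1)))
        = t * ?D v (t *\<^sub>R p) p + a (t *\<^sub>R p) v" if t: "t \<in> {0..1}" for t
      proof -
        have tB: "t *\<^sub>R p \<in> ?B" using tpB t by blast
        have "linear (?D v (t *\<^sub>R p))"
          by (rule has_derivative_linear[OF Ck_on_has_derivative[OF C open_ball tB]])
        from linear_vec2[OF this, of p] linear_vec2[OF lin[OF tB], of v]
        show ?thesis
          unfolding closed[OF tp[OF t], of _ v] by (simp add: algebra_simps)
      qed
      \<comment> \<open>The integrand is the derivative of \<open>t * a (t *\<^sub>R p) v\<close>,
        which is 0 at \<open>t = 0\<close> and \<open>a p v\<close> at \<open>t = 1\<close>.\<close>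
      have 3: "((\<lambda>t. t * ?D v (t *\<^sub>R p) p + a (t *\<^sub>R p) v) has_integral
          1 * a (1 *\<^sub>R p) v - 0 * a (0 *\<^sub>R p) v) {0..1}"
      proof (rule fundamental_theorem_of_calculus)
        fix t :: real assume t: "t \<in> {0..1}"
        have "0 + t *\<^sub>R p \<in> ?B" unfolding add_0 using tpB t by blast
        then have "((\<lambda>t. a (0 + t *\<^sub>R p) v) has_field_derivative ?D v (0 + t *\<^sub>R p) p) (at t)"
          by (intro DERIV_along_line Ck_on_has_derivative[OF C open_ball])
        then have "((\<lambda>t. a (t *\<^sub>R p) v) has_field_derivative ?D v (t *\<^sub>R p) p) (at t within {0..1})"
          by (auto intro: has_field_derivative_at_within)
        then show "((\<lambda>t. t * a (t *\<^sub>R p) v) has_vector_derivative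
            t * ?D v (t *\<^sub>R p) p + a (t *\<^sub>R p) v) (at t within {0..1})"
          unfolding has_real_derivative_iff_has_vector_derivative[symmetric]
          by (auto intro!: derivative_eq_intros)
      qed simp
      show ?thesis
        using has_integral_unique[OF has_integral_eq[OF 2 1] 3] by simp
    qed
    then show ?thesis using dF by simp
  qed
  with CF show ?thesis by (rule that)
qed

section \<open>Exactness of \<eta> minus its pullback\<close>

lemma \<eta>_eq: "\<eta> p v = (p$1 * v$2 - p$2 * v$1) / 2"
  by (simp add: \<eta>_def dx_def dy_def)

text \<open>Unit Jacobian determinant; it serves both the closedness of \<eta> minus its pullback
  and the change of variables.\<close>

lemma Symp_disk_det:
  assumes "g \<in> Symp_disk" "p \<in> disk"
  shows "(diff_at g p u)$1 * (diff_at g p v)$2 - (diff_at g p v)$1 * (diff_at g p u)$2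
    = u$1 * v$2 - v$1 * u$2"
proof -
  have "pullback2 g \<omega> p u v = \<omega> p u v" using assms by (simp add: Symp_disk_def)
  then show ?thesis by (simp add: pullback2_def \<omega>_def wedge_def dx_def dy_def)
qed

lemma Symp_disk_smooth: "g \<in> Symp_disk \<Longrightarrow> smooth_on disk g"
  by (simp add: Symp_disk_def Diff_disk_def)

lemma Symp_disk_image: "g \<in> Symp_disk \<Longrightarrow> g ` disk = disk"
  and Symp_disk_inj: "g \<in> Symp_disk \<Longrightarrow> inj_on g disk"
  by (simp_all add: Symp_disk_def Diff_disk_def bij_betw_def)

text \<open>On the disk the exterior derivative of \<eta> minus its pullback is \<omega> minus its
  pullback, which vanishes, so the radial construction yields a primitive.\<close>

lemma Symp_disk_primitive:
  assumes g: "g \<in> Symp_disk"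
  obtains F where "smooth_on disk F"
    "\<And>p. p \<in> disk \<Longrightarrow> (F has_derivative form1_diff \<eta> (pullback1 g \<eta>) p) (at p within disk)"
proof -
  obtain R G where R: "R > 1" and CG: "\<And>k. Ck_on k (ball 0 R) G"
    and eq: "\<And>p. p \<in> disk \<Longrightarrow> G p = g p"
    and dg: "\<And>p. p \<in> disk \<Longrightarrow> diff_at g p = frechet_derivative G (at p)"
    using smooth_on_diskE[OF Symp_disk_smooth[OF g]] by metis
  let ?B = "ball (0::real^2) R"
  let ?G = "\<lambda>i q. G q $ i"
  let ?D = "\<lambda>i q. frechet_derivative (?G i) (at q)"
  let ?D2 = "\<lambda>i v q. frechet_derivative (\<lambda>q. ?D i q v) (at q)"
  have C: "Ck_on k ?B (?G i)" for k i
    by (rule Ck_on_linear_compose[OF bounded_linear_vec_nth open_ball CG])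
  have CD: "Ck_on k ?B (\<lambda>q. ?D i q v)" for k i v
    using C[of "Suc k" i] by simp
  have D: "(?G i has_derivative ?D i q) (at q)" if "q \<in> ?B" for i q
    using Ck_on_has_derivative[OF C open_ball that] .
  have D2: "((\<lambda>q. ?D i q v) has_derivative ?D2 i v q) (at q)" if "q \<in> ?B" for i v q
    using Ck_on_has_derivative[OF CD open_ball that] .
  have comp: "frechet_derivative G (at q) v $ i = ?D i q v" if "q \<in> ?B" for q v i
  proof -
    have "(?G i has_derivative (\<lambda>v. frechet_derivative G (at q) v $ i)) (at q)"
      by (rule bounded_linear.has_derivative[OF bounded_linear_vec_nth Ck_on_has_derivative[OF CG open_ball that]])
    then show ?thesis by (rule fun_cong[OF has_derivative_unique[OF _ D[OF that]]])
  qed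
  \<comment> \<open>The components of \<open>G\<close> extend \<eta> minus its pullback to the ball,
    where it need not be closed.\<close>
  define a where "a q v = (q$1 * v$2 - q$2 * v$1) * (1/2) - (?G 1 q * ?D 2 q v - ?G 2 q * ?D 1 q v) * (1/2)" for q v
  have Ca: "Ck_on k ?B (\<lambda>q. a q v)" for k v
    unfolding a_def
    by (intro Ck_on_diff Ck_on_mult C CD Ck_on_const Ck_on_bounded_linear bounded_linear_vec_nth open_ball)
  have lin: "linear (a q)" if "q \<in> ?B" for q
    using has_derivative_linear[OF D[OF that, of 1]] has_derivative_linear[OF D[OF that, of 2]]
    by (auto simp: a_def linear_iff algebra_simps)
  have da: "frechet_derivative (\<lambda>q. a q v) (at q) u = (u$1 * v$2 - u$2 * v$1) * (1/2) -
     ((?G 1 q * ?D2 2 v q u + ?D 1 q u * ?D 2 q v) - (?G 2 q * ?D2 1 v q u + ?D 2 q u * ?D 1 q v)) * (1/2)"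
    if q: "q \<in> ?B" for q u v
  proof -
    have "((\<lambda>q. a q v) has_derivative (\<lambda>u. (u$1 * v$2 - u$2 * v$1) * (1/2) -
     ((?G 1 q * ?D2 2 v q u + ?D 1 q u * ?D 2 q v) - (?G 2 q * ?D2 1 v q u + ?D 2 q u * ?D 1 q v)) * (1/2))) (at q)"
      unfolding a_def
      by (intro has_derivative_diff has_derivative_mult_left has_derivative_mult D D2 q
          bounded_linear_imp_has_derivative bounded_linear_vec_nth)
    then show ?thesis by (rule fun_cong[OF frechet_derivative_at[symmetric]])
  qed
  have diskB: "q \<in> ?B" if "q \<in> disk" for q using that R by (auto simp: disk_eq_cball)
  \<comment> \<open>Symmetry of second derivatives cancels the terms in \<open>?D2\<close>; what
    remains is the Jacobian determinant against that of the identity.\<close>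
  have closed: "frechet_derivative (\<lambda>q. a q v) (at q) u = frechet_derivative (\<lambda>q. a q u) (at q) v"
    if q: "q \<in> disk" for q u v
  proof -
    have "?D2 i v q u = ?D2 i u q v" for i
      by (rule mixed_partials_commute[OF C open_ball diskB[OF q]])
    moreover have "?D 1 q u * ?D 2 q v - ?D 1 q v * ?D 2 q u = u$1 * v$2 - v$1 * u$2"
      using Symp_disk_det[OF g q, of u v] unfolding dg[OF q] comp[OF diskB[OF q]] .
    ultimately show ?thesis
      unfolding da[OF diskB[OF q]] by (simp add: algebra_simps)
  qed
  obtain F where CF: "\<And>k. Ck_on k ?B F" and dF: "\<And>p. p \<in> disk \<Longrightarrow> (F has_derivative a p) (at p)"
    using poincare_on_disk[OF R Ca lin closed] by blast
  have "smooth_on disk F"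
    unfolding smooth_on_def using CF diskB by (intro exI[of _ ?B] exI[of _ F]) auto
  moreover have "(F has_derivative form1_diff \<eta> (pullback1 g \<eta>) p) (at p within disk)" if p: "p \<in> disk" for p
  proof -
    have "a p = form1_diff \<eta> (pullback1 g \<eta>) p"
      by (simp add: fun_eq_iff a_def form1_diff_def pullback1_def \<eta>_eq dg[OF p] comp[OF diskB[OF p]] eq[OF p])
    with dF[OF p] show ?thesis by (metis has_derivative_at_withinI)
  qed
  ultimately show ?thesis by (rule that)
qed

section \<open>Polar coordinates and the divergence theorem\<close>

text \<open>The angle is counted in turns, so that the unit square covers the disk and rays end on
  \<open>disk_boundary\<close>.\<close>

definition polar :: "real^2 \<Rightarrow> real^2" where
  "polar p = (p$1 * cos (2*pi*p$2)) *\<^sub>R axis 1 1 + (p$1 * sin (2*pi*p$2)) *\<^sub>R axis 2 1"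

lemma polar_nth [simp]: "polar p $ 1 = p$1 * cos (2*pi*p$2)" "polar p $ 2 = p$1 * sin (2*pi*p$2)"
  by (simp_all add: polar_def axis_def)

lemma polar_eq_disk_boundary: "polar p = p$1 *\<^sub>R disk_boundary (p$2)"
  by (simp add: vec_eq_iff forall_2 disk_boundary_def)

lemma has_derivative_polar:
  "(polar has_derivative (\<lambda>v.
     (v$1 * cos (2*pi*p$2) - p$1 * (sin (2*pi*p$2) * (2*pi * v$2))) *\<^sub>R axis 1 1 +
     (v$1 * sin (2*pi*p$2) + p$1 * (cos (2*pi*p$2) * (2*pi * v$2))) *\<^sub>R axis 2 1)) (at p within S)"
proof -
  have n: "((\<lambda>p. p$i) has_derivative (\<lambda>v. v$i)) (at p within S)" for i :: 2
    by (rule bounded_linear_imp_has_derivative[OF bounded_linear_vec_nth])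
  show ?thesis
    unfolding polar_def
    by (rule derivative_eq_intros n refl)+ (auto simp: algebra_simps)
qed

lemma det_polar:
  fixes p :: "real^2"
  shows "det (matrix (\<lambda>v::real^2.
     (v$1 * cos (2*pi*p$2) - p$1 * (sin (2*pi*p$2) * (2*pi * v$2))) *\<^sub>R axis 1 1 +
     (v$1 * sin (2*pi*p$2) + p$1 * (cos (2*pi*p$2) * (2*pi * v$2))) *\<^sub>R axis 2 1 :: real^2))
   = 2 * pi * p$1"
proof -
  have "det (matrix (\<lambda>v::real^2. (v$1 * c - r * (s * (2*pi * v$2))) *\<^sub>R axis 1 1 +
      (v$1 * s + r * (c * (2*pi * v$2))) *\<^sub>R axis 2 1 :: real^2)) = 2 * pi * r * (s\<^sup>2 + c\<^sup>2)"
    for r s c :: real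
    by (simp add: det_2 matrix_def axis_def algebra_simps power2_eq_square)
  then show ?thesis by simp
qed

text \<open>The radius is recovered from the sum of squares, and the angle up to a whole number of
  turns, which the half-open range forces to be 0.\<close>

lemma inj_on_polar: "inj_on polar {p. 0 < p$1 \<and> 0 \<le> p$2 \<and> p$2 < 1}"
proof (rule inj_onI)
  fix p q :: "real^2"
  assume p: "p \<in> {p. 0 < p$1 \<and> 0 \<le> p$2 \<and> p$2 < 1}" and q: "q \<in> {p. 0 < p$1 \<and> 0 \<le> p$2 \<and> p$2 < 1}"
    and eq: "polar p = polar q"
  have c: "p$1 * cos (2*pi*p$2) = q$1 * cos (2*pi*q$2)" and s: "p$1 * sin (2*pi*p$2) = q$1 * sin (2*pi*q$2)"
    using arg_cong[OF eq, of "\<lambda>p. p$1"] arg_cong[OF eq, of "\<lambda>p. p$2"] by simp_all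
  have sq: "(r * cos t)\<^sup>2 + (r * sin t)\<^sup>2 = r\<^sup>2" for r t :: real
    by (simp add: power_mult_distrib flip: distrib_left)
  have "(p$1)\<^sup>2 = (q$1)\<^sup>2"
    using sq[of "p$1" "2*pi*p$2"] sq[of "q$1" "2*pi*q$2"] unfolding c s by simp
  then have r: "p$1 = q$1" using p q by (simp add: power2_eq_iff_nonneg)
  have "cos (2*pi*p$2) = cos (2*pi*q$2)" "sin (2*pi*p$2) = sin (2*pi*q$2)"
    using c s r p q by auto
  then obtain n :: int where "2*pi*p$2 = 2*pi*q$2 + 2*pi*n"
    using sin_cos_eq_iff by metis
  then have n: "p$2 = q$2 + n"
    by (metis distrib_left mult_cancel_left pi_neq_zero zero_neq_numeral no_zero_divisors)
  then have "\<bar>real_of_int n\<bar> < 1" using p q by auto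
  then have "n = 0" by linarith
  then show "p = q" using n r by (simp add: vec_eq_iff forall_2)
qed

text \<open>Only the origin is missed, as radius 0 is excluded to keep \<open>polar\<close>
  injective; the angle comes from the point \<open>q / r\<close> of the unit circle.\<close>

lemma polar_image: "polar ` {p. 0 < p$1 \<and> p$1 \<le> 1 \<and> 0 \<le> p$2 \<and> p$2 < 1} = disk - {0}"
proof (intro equalityI subsetI)
  fix q assume "q \<in> polar ` {p. 0 < p$1 \<and> p$1 \<le> 1 \<and> 0 \<le> p$2 \<and> p$2 < 1}"
  then obtain p where p: "0 < p$1" "p$1 \<le> 1" and q: "q = polar p" by auto
  have *: "(q$1)\<^sup>2 + (q$2)\<^sup>2 = (p$1)\<^sup>2"
    unfolding q by (simp add: power_mult_distrib flip: distrib_left)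
  have "(p$1)\<^sup>2 \<le> 1" "(p$1)\<^sup>2 \<noteq> 0" using p by (simp_all add: power_le_one)
  with * show "q \<in> disk - {0}" by (auto simp: disk_def)
next
  fix q :: "real^2" assume "q \<in> disk - {0}"
  then have q: "q \<in> disk" "q \<noteq> 0" by auto
  define r where "r = sqrt ((q$1)\<^sup>2 + (q$2)\<^sup>2)"
  have r2: "r\<^sup>2 = (q$1)\<^sup>2 + (q$2)\<^sup>2" by (simp add: r_def)
  have "(q$1)\<^sup>2 + (q$2)\<^sup>2 > 0"
    using q(2) by (auto simp: vec_eq_iff forall_2 sum_power2_gt_zero_iff)
  then have r: "r > 0" by (simp add: r_def)
  have r1: "r \<le> 1" using q(1) by (simp add: r_def disk_def)
  have "(q$1 / r)\<^sup>2 + (q$2 / r)\<^sup>2 = 1"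
    using r unfolding power_divide add_divide_distrib[symmetric] r2[symmetric] by simp
  then obtain t where t: "0 \<le> t" "t < 2*pi" "q$1 / r = cos t" "q$2 / r = sin t"
    using sincos_total_2pi by metis
  define p :: "real^2" where "p = vector [r, t / (2*pi)]"
  have "q = polar p"
    using t r by (auto simp: vec_eq_iff forall_2 p_def field_simps)
  then show "q \<in> polar ` {p. 0 < p$1 \<and> p$1 \<le> 1 \<and> 0 \<le> p$2 \<and> p$2 < 1}"
    by (rule image_eqI) (use t r r1 in \<open>simp add: p_def\<close>)
qed

section \<open>Integration in polar coordinates\<close>

text \<open>Fubini's theorem on pairs of reals, transported to \<open>real^2\<close> by a
  volume-preserving swap of coordinates that makes the angle the outer variable.\<close>

lemma integral_unit_square:
  fixes f :: "real^2 \<Rightarrow> real"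
  assumes "continuous_on (cbox 0 1) f"
  shows "integral (cbox 0 1) f = integral {0..1} (\<lambda>t. integral {0..1} (\<lambda>r. f (vector [r, t])))"
proof -
  define g :: "real \<times> real \<Rightarrow> real^2" where "g = (\<lambda>x. snd x *\<^sub>R axis 1 1 + fst x *\<^sub>R axis 2 1)"
  define h :: "real^2 \<Rightarrow> real \<times> real" where "h y = (y$2, y$1)" for y
  have gv: "g (t, r) = vector [r, t]" for t r by (simp add: g_def vec_eq_iff forall_2 axis_def)
  have hg: "h (g x) = x" and gh: "g (h y) = y" for x y
    by (simp_all add: g_def h_def vec_eq_iff forall_2 axis_def)
  have gb: "g ` cbox u v = cbox (g u) (g v)" for u v
  proof -
    have "g ` cbox u v = {y. h y \<in> cbox u v}" 
    proof safe
      fix y assume "h y \<in> cbox u v"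
      then have "g (h y) \<in> g ` cbox u v" by (rule imageI)
      then show "y \<in> g ` cbox u v" by (simp only: gh)
    qed (simp add: hg)
    also have "\<dots> = cbox (g u) (g v)"
      by (cases u; cases v) (auto simp: h_def g_def mem_box_cart forall_2 axis_def)
    finally show ?thesis .
  qed
  have hb: "h ` cbox u v = cbox (h u) (h v)" for u v
  proof -
    have "cbox u v = g ` cbox (h u) (h v)" by (simp add: gb gh)
    then show ?thesis by (simp add: image_image hg)
  qed
  have ct: "measure lborel (g ` cbox u v) = 1 * measure lborel (cbox u v)" for u v
  proof (cases "cbox u v = {}")
    case False
    obtain a b c d where uv: "u = (a,b)" "v = (c,d)" by (metis surj_pair)
    have "a \<le> c" "b \<le> d" using False by (auto simp: uv cbox_Pair_eq)
    moreover have "cbox (g u) (g v) \<noteq> {}" using False gb by (metis image_is_empty)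
    ultimately show ?thesis
      unfolding gb by (simp add: uv content_Pair content_cbox_cart g_def axis_def UNIV_2 mult.commute)
  qed simp
  have contg: "continuous_on S g" for S unfolding g_def by (intro continuous_intros)
  have "(f has_integral integral (cbox 0 1) f) (cbox 0 1)"
    by (intro integrable_integral integrable_continuous assms)
  then have "((\<lambda>x. f (g x)) has_integral (1 / 1) *\<^sub>R integral (cbox 0 1) f) (h ` cbox 0 1)"
  proof (rule has_integral_twiddle[rotated 7])
    show "continuous (at x) g" for x unfolding g_def by (intro continuous_intros)
    show "\<exists>w z. g ` cbox u v = cbox w z" for u v using gb by blast
    show "\<exists>w z. h ` cbox u v = cbox w z" for u v using hb by blast
  qed (simp_all add: hg gh ct)
  then have "integral (cbox (0,0) (1,1)) (\<lambda>x. f (g x)) = integral (cbox 0 1) f"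
    unfolding hb by (simp add: h_def integral_unique)
  moreover have "g ` cbox (0,0) (1,1) = cbox 0 1"
  proof -
    have "vector [0, 0] = (0::real^2)" "vector [1, 1] = (1::real^2)"
      by (simp_all add: vec_eq_iff forall_2)
    then show ?thesis unfolding gb gv by simp
  qed
  then have "continuous_on (cbox (0,0) (1,1)) (\<lambda>x. f (g x))"
    by (intro continuous_on_compose2[OF assms contg]) simp
  note integral_prod_continuous[OF this]
  ultimately show ?thesis by (simp add: gv cbox_interval)
qed

lemma disk_boundary_eq: "disk_boundary t = cos (2*pi*t) *\<^sub>R axis 1 1 + sin (2*pi*t) *\<^sub>R axis 2 1"
  by (simp add: disk_boundary_def vec_eq_iff forall_2 axis_def)

lemma scaled_disk_boundary_in_disk:
  assumes "0 \<le> r" "r \<le> 1"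
  shows "r *\<^sub>R disk_boundary t \<in> disk"
proof -
  have "(r * cos (2*pi*t))\<^sup>2 + (r * sin (2*pi*t))\<^sup>2 = r\<^sup>2"
    by (simp add: power_mult_distrib flip: distrib_left)
  with assms show ?thesis by (simp add: disk_def disk_boundary_def power_le_one)
qed

text \<open>Change of variables is applied on the half-open rectangle, where \<open>polar\<close> is
  injective; closing it up to the square and adding the origin to the image alters only null
  sets.\<close>

lemma integral_disk_polar:
  fixes f :: "real^2 \<Rightarrow> real"
  assumes f: "continuous_on disk f"
  shows "f absolutely_integrable_on disk"
    and "integral disk f =
      integral {0..1} (\<lambda>t. integral {0..1} (\<lambda>r. 2 * pi * r * f (r *\<^sub>R disk_boundary t)))"
proof -
  let ?S = "{p::real^2. 0 < p$1 \<and> p$1 \<le> 1 \<and> 0 \<le> p$2 \<and> p$2 < 1}"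
  let ?Q = "cbox 0 (1::real^2)"
  let ?h = "\<lambda>p. 2 * pi * p$1 * f (polar p)"
  have Q: "p \<in> ?Q \<longleftrightarrow> 0 \<le> p$1 \<and> p$1 \<le> 1 \<and> 0 \<le> p$2 \<and> p$2 \<le> 1" for p
    by (auto simp: mem_box_cart forall_2)
  have pd: "polar ` ?Q \<subseteq> disk"
    by (auto simp: Q polar_eq_disk_boundary intro: scaled_disk_boundary_in_disk)
  have "continuous_on ?Q polar"
    using has_derivative_polar by (rule has_derivative_continuous_on)
  from continuous_on_compose2[OF f this pd] have ch: "continuous_on ?Q ?h"
    by (intro continuous_intros)
  have eqS: "?S = ?Q - {p. axis 1 1 \<bullet> p = 0} - {p. axis 2 1 \<bullet> p = 1}"
    by (auto simp: Q inner_axis')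
  have "{p::real^2. axis i 1 \<bullet> p = c} \<in> sets lebesgue" for i c
    by (simp add: borel_closed closed_hyperplane)
  then have S: "?S \<in> sets lebesgue"
    unfolding eqS by (intro sets.Diff) auto
  have neg: "negligible (?Q - ?S)"
  proof (rule negligible_subset)
    show "negligible ({p::real^2. axis 1 1 \<bullet> p = 0} \<union> {p. axis 2 1 \<bullet> p = 1})"
      by (intro negligible_Un negligible_hyperplane) (simp_all add: axis_eq_0_iff)
    show "?Q - ?S \<subseteq> {p. axis 1 1 \<bullet> p = 0} \<union> {p. axis 2 1 \<bullet> p = 1}"
      unfolding eqS by blast
  qed
  have SQ: "?S \<subseteq> ?Q" by (auto simp: Q)
  have ih: "?h absolutely_integrable_on ?S"
    using absolutely_integrable_continuous[OF ch] S SQ by (rule set_integrable_subset)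
  have inth: "integral ?S ?h = integral ?Q ?h"
    by (rule integral_subset_negligible[OF SQ neg])
  have inj: "inj_on polar ?S" by (rule inj_on_subset[OF inj_on_polar]) auto
  \<comment> \<open>The change of variables theorem is for vector-valued functions, hence the detour
    through \<open>real^1\<close>. On \<open>?S\<close> the radius is positive, so the absolute
    value of the determinant is \<open>2 * pi * p$1\<close>.\<close>
  let ?f1 = "\<lambda>p. vec (f p) :: real^1"
  let ?g' = "\<lambda>p v. (v$1 * cos (2*pi*p$2) - p$1 * (sin (2*pi*p$2) * (2*pi * v$2))) *\<^sub>R axis 1 1 +
     (v$1 * sin (2*pi*p$2) + p$1 * (cos (2*pi*p$2) * (2*pi * v$2))) *\<^sub>R axis 2 1 :: real^2"
  let ?h1 = "\<lambda>p. \<bar>det (matrix (?g' p))\<bar> *\<^sub>R ?f1 (polar p)"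
  have h1: "?h1 p $ 1 = ?h p" if "p \<in> ?S" for p
    unfolding det_polar using that by simp
  have h1i: "(\<lambda>p. ?h1 p $ 1) absolutely_integrable_on ?S"
    using ih by (rule absolutely_integrable_spike[OF _ negligible_empty]) (use h1 in auto)
  have "integral ?S (\<lambda>p. ?h1 p $ 1) = integral ?S ?h"
    by (rule integral_cong[OF h1])
  then have "?h1 absolutely_integrable_on ?S \<and> integral ?S ?h1 = vec (integral ?S ?h)"
    using h1i by (simp only: absolutely_integrable_on_1_iff integral_on_1_eq[of ?S ?h1])
  then have "?f1 absolutely_integrable_on (polar ` ?S) \<and> integral (polar ` ?S) ?f1 = vec (integral ?S ?h)"
    by (rule has_absolute_integral_change_of_variables[OF S has_derivative_polar inj, THEN iffD1])
  then have D: "f absolutely_integrable_on (disk - {0})" "integral (disk - {0}) f = integral ?S ?h"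
    unfolding polar_image absolutely_integrable_on_1_iff integral_on_1_eq[of _ ?f1]
    by (simp_all add: vec_eq_iff)
  show "f absolutely_integrable_on disk"
    using D(1) by (rule absolutely_integrable_spike_set) (auto intro: negligible_subset[of "{0}"])
  have "integral disk f = integral (disk - {0}) f"
    by (rule integral_subset_negligible[symmetric]) (auto intro: negligible_subset[of "{0}"])
  also have "\<dots> = integral ?Q ?h" using D(2) inth by simp
  also have "\<dots> = integral {0..1} (\<lambda>t. integral {0..1} (\<lambda>r. ?h (vector [r, t])))"
    by (rule integral_unit_square[OF ch])
  also have "\<dots> = integral {0..1} (\<lambda>t. integral {0..1} (\<lambda>r. 2 * pi * r * f (r *\<^sub>R disk_boundary t)))"
    by (simp add: polar_eq_disk_boundary)
  finally show "integral disk f =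
      integral {0..1} (\<lambda>t. integral {0..1} (\<lambda>r. 2 * pi * r * f (r *\<^sub>R disk_boundary t)))" .
qed

text \<open>The integrand on the left is the divergence of \<open>p K(p)\<close>. Times the polar
  density \<open>2 * pi * r\<close> it is the derivative of \<open>2 * pi * r\<^sup>2 K\<close>
  along each radius, so only the boundary value survives.\<close>

lemma divergence_disk_radial:
  fixes K :: "real^2 \<Rightarrow> real"
  assumes K: "smooth_on disk K"
  shows "integral disk (\<lambda>p. 2 * K p + diff_at K p p) = 2 * pi * integral {0..1} (\<lambda>t. K (disk_boundary t))"
proof -
  let ?D = "diff_at K"
  have d: "(K has_derivative ?D p) (at p within disk)" if "p \<in> disk" for p
    by (rule smooth_on_disk_has_derivative[OF K that])
  \<comment> \<open>Continuity of \<open>diff_at\<close> is available for a fixed direction, so the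
    moving direction \<open>p\<close> is expanded in the basis.\<close>
  have "continuous_on disk (\<lambda>p. p$1 *\<^sub>R ?D p (axis 1 1) + p$2 *\<^sub>R ?D p (axis 2 1))"
    by (intro continuous_intros smooth_on_disk_continuous_on_diff_at K)
  then have "continuous_on disk (\<lambda>p. ?D p p)"
    by (rule continuous_on_eq) (rule linear_vec2[OF has_derivative_linear[OF d], symmetric])
  then have c: "continuous_on disk (\<lambda>p. 2 * K p + ?D p p)"
    by (intro continuous_on_add continuous_on_mult continuous_on_const smooth_on_disk_continuous[OF K])
  have "integral {0..1} (\<lambda>r. 2 * pi * r * (2 * K (r *\<^sub>R disk_boundary t) +
     ?D (r *\<^sub>R disk_boundary t) (r *\<^sub>R disk_boundary t))) = 2 * pi * K (disk_boundary t)" for t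
  proof -
    let ?e = "disk_boundary t"
    have "((\<lambda>r. 2 * pi * r * (2 * K (r *\<^sub>R ?e) + ?D (r *\<^sub>R ?e) (r *\<^sub>R ?e))) has_integral
       (2 * pi * 1\<^sup>2 * K (1 *\<^sub>R ?e) - 2 * pi * 0\<^sup>2 * K (0 *\<^sub>R ?e))) {0..1}"
    proof (rule fundamental_theorem_of_calculus)
      fix r :: real assume r: "r \<in> {0..1}"
      have sub: "(\<lambda>r. r *\<^sub>R ?e) ` {0..1} \<subseteq> disk" by (auto intro: scaled_disk_boundary_in_disk)
      have re: "r *\<^sub>R ?e \<in> disk" using sub r by blast
      have L: "linear (?D (r *\<^sub>R ?e))" by (rule has_derivative_linear[OF d[OF re]])
      have "((\<lambda>r. K (r *\<^sub>R ?e)) has_derivative (\<lambda>s. ?D (r *\<^sub>R ?e) (s *\<^sub>R ?e))) (at r within {0..1})"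
        by (rule has_derivative_in_compose[where f="\<lambda>r. r *\<^sub>R ?e", OF _ has_derivative_subset[OF d[OF re] sub]])
          (auto intro!: derivative_eq_intros)
      then have "((\<lambda>r. K (r *\<^sub>R ?e)) has_field_derivative ?D (r *\<^sub>R ?e) ?e) (at r within {0..1})"
        unfolding has_field_derivative_def linear_cmul[OF L] by (simp add: mult_commute_abs)
      then have "((\<lambda>r. 2 * pi * r\<^sup>2 * K (r *\<^sub>R ?e)) has_field_derivative
          2 * pi * r\<^sup>2 * ?D (r *\<^sub>R ?e) ?e + 2 * pi * (2 * r) * K (r *\<^sub>R ?e)) (at r within {0..1})"
        by (auto intro!: derivative_eq_intros)
      moreover have "2 * pi * r\<^sup>2 * ?D (r *\<^sub>R ?e) ?e + 2 * pi * (2 * r) * K (r *\<^sub>R ?e) =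
         2 * pi * r * (2 * K (r *\<^sub>R ?e) + ?D (r *\<^sub>R ?e) (r *\<^sub>R ?e))"
        unfolding linear_cmul[OF L] by (simp add: algebra_simps power2_eq_square)
      ultimately show "((\<lambda>r. 2 * pi * r\<^sup>2 * K (r *\<^sub>R ?e)) has_vector_derivative
          2 * pi * r * (2 * K (r *\<^sub>R ?e) + ?D (r *\<^sub>R ?e) (r *\<^sub>R ?e))) (at r within {0..1})"
        by (simp only: has_real_derivative_iff_has_vector_derivative)
    qed simp
    then show ?thesis by (simp add: integral_unique)
  qed
  then show ?thesis unfolding integral_disk_polar(2)[OF c] by simp
qed

section \<open>The coboundary\<close>

lemma x0_in_disk: "x\<^sub>0 \<in> disk"
  by (simp add: x\<^sub>0_def disk_def)

section \<open>Evaluation through primitives\<close>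

text \<open>No value at \<open>x\<^sub>0\<close> is prescribed: primitives then add under
  composition without correction, and \<K> and \<open>ILM\<close> can be evaluated from any of
  them.\<close>

definition primitive :: "(real^2 \<Rightarrow> real^2) \<Rightarrow> (real^2 \<Rightarrow> real) \<Rightarrow> bool" where
  "primitive g F \<longleftrightarrow> smooth_on disk F \<and>
     (\<forall>p\<in>disk. (F has_derivative form1_diff \<eta> (pullback1 g \<eta>) p) (at p within disk))"

text \<open>Uniqueness holds because a function with zero derivative on the convex disk is
  constant.\<close>

lemma \<K>_eq_primitive:
  assumes F: "primitive g F"
  shows "\<K> \<eta> x\<^sub>0 g = restrict (\<lambda>p. F p - F x\<^sub>0) disk"
  unfolding \<K>_def
proof (rule the_equality)
  let ?K = "restrict (\<lambda>p. F p - F x\<^sub>0) disk"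
  let ?a = "form1_diff \<eta> (pullback1 g \<eta>)"
  have dF: "(F has_derivative ?a p) (at p within disk)" if "p \<in> disk" for p
    using F that by (simp add: primitive_def)
  have "smooth_on disk (\<lambda>p. F p + (- F x\<^sub>0))"
    using F unfolding primitive_def by (intro smooth_on_add smooth_on_const) simp
  then have "smooth_on disk ?K" by (rule smooth_on_cong) simp
  moreover have "diff_at ?K p = ?a p" if p: "p \<in> disk" for p
  proof (rule diff_at_eqI[OF _ p])
    have "((\<lambda>p. F p - F x\<^sub>0) has_derivative ?a p) (at p within disk)"
      using has_derivative_diff[OF dF[OF p] has_derivative_const[of "F x\<^sub>0"]] by simp
    then show "(?K has_derivative ?a p) (at p within disk)"
      by (rule has_derivative_transform[OF p, rotated]) simp
  qed
  ultimately show "?K \<in> extensional disk \<and> smooth_on disk ?K \<and>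
      (\<forall>p\<in>disk. diff_at ?K p = ?a p) \<and> ?K x\<^sub>0 = 0"
    using x0_in_disk by simp
  fix K assume K: "K \<in> extensional disk \<and> smooth_on disk K \<and>
      (\<forall>p\<in>disk. diff_at K p = ?a p) \<and> K x\<^sub>0 = 0"
  have "((\<lambda>p. K p - F p) has_derivative (\<lambda>_. 0)) (at p within disk)" if p: "p \<in> disk" for p
  proof -
    have "(K has_derivative ?a p) (at p within disk)"
      using smooth_on_disk_has_derivative[of K p] K p by simp
    from has_derivative_diff[OF this dF[OF p]] show ?thesis by simp
  qed
  then have "K p - F p = K x\<^sub>0 - F x\<^sub>0" if "p \<in> disk" for p
    by (rule has_derivative_zero_unique[OF convex_disk _ that x0_in_disk])
  then show "K = ?K"
    using K by (intro extensionalityI[of _ disk]) (auto simp: algebra_simps)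
qed

text \<open>As the circle is traversed once in unit time, \<eta> takes the value \<open>pi\<close>
  on its tangent vectors.\<close>

lemma line_integral_disk_boundary:
  "line_integral (\<lambda>p v. K p * \<eta> p v) disk_boundary = pi * integral {0..1} (\<lambda>t. K (disk_boundary t))"
proof -
  have "K (disk_boundary t) * \<eta> (disk_boundary t) (vector_derivative disk_boundary (at t within {0..1}))
     = pi * K (disk_boundary t)" if t: "t \<in> {0..1}" for t
  proof -
    let ?v = "(- sin (2*pi*t) * (2*pi)) *\<^sub>R axis 1 1 + (cos (2*pi*t) * (2*pi)) *\<^sub>R axis 2 1 :: real^2"
    have "(disk_boundary has_vector_derivative ?v) (at t within {0..1})"
      unfolding disk_boundary_eq has_vector_derivative_def
      by (rule derivative_eq_intros refl)+ (auto simp: algebra_simps)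
    then have v: "vector_derivative disk_boundary (at t within {0..1}) = ?v"
      using vector_derivative_within_cbox[of 0 1 t] t by (simp add: cbox_interval)
    have "\<eta> (c *\<^sub>R axis 1 1 + s *\<^sub>R axis 2 1)
        ((- s * (2*pi)) *\<^sub>R axis 1 1 + (c * (2*pi)) *\<^sub>R axis 2 1) = pi * (s\<^sup>2 + c\<^sup>2)" for s c
      by (simp add: \<eta>_eq axis_def power2_eq_square algebra_simps add_divide_distrib)
    then show ?thesis unfolding v unfolding disk_boundary_eq by simp
  qed
  then have "line_integral (\<lambda>p v. K p * \<eta> p v) disk_boundary
      = integral {0..1} (\<lambda>t. pi * K (disk_boundary t))"
    unfolding line_integral_def by (rule integral_cong)
  then show ?thesis by simp
qed

text \<open>The divergence formula turns \<kappa> into the integral of \<open>F\<close> plus half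
  that of \<open>diff_at F p p\<close>, and \<open>\<tau>\<^sub>0\<close> is minus this half.
  Normalising \<open>F\<close> costs \<open>pi * F x\<^sub>0\<close>, since \<eta> integrates to
  \<open>pi\<close> over the circle.\<close>

lemma \<tau>'_eq_primitive:
  assumes F: "primitive g F"
  shows "\<tau>' g = integral disk F - pi * F x\<^sub>0"
proof -
  let ?D = "diff_at F"
  have S: "smooth_on disk F" using F by (simp add: primitive_def)
  have dF: "?D p = form1_diff \<eta> (pullback1 g \<eta>) p" if "p \<in> disk" for p
    using F that by (intro diff_at_eqI) (simp_all add: primitive_def)
  have L: "linear (?D p)" if "p \<in> disk" for p
    by (rule has_derivative_linear[OF smooth_on_disk_has_derivative[OF S that]])
  \<comment> \<open>With the pullback written as \<eta> minus \<open>?D p\<close>, the products of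
    \<open>?D p\<close> with itself cancel, and \<eta> has the values \<open>- p$2 / 2\<close> and
    \<open>p$1 / 2\<close> on the basis vectors.\<close>
  have "wedge (pullback1 g \<eta>) (form1_diff \<eta> (pullback1 g \<eta>)) p (axis 1 1) (axis 2 1) = (-1/2) * ?D p p"
    if p: "p \<in> disk" for p
  proof -
    have pb: "pullback1 g \<eta> p v = \<eta> p v - ?D p v" for v
      using dF[OF p] by (simp add: form1_diff_def)
    show ?thesis
      unfolding wedge_def dF[OF p, symmetric] linear_vec2[OF L[OF p], of p] pb
      by (simp add: \<eta>_eq axis_def field_simps)
  qed
  then have \<tau>0: "\<tau>\<^sub>0 g = integral disk (\<lambda>p. (-1/2) * ?D p p)"
    unfolding \<tau>\<^sub>0_def disk_integral_def by (rule integral_cong)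
  have e: "disk_boundary t \<in> disk" for t
    using scaled_disk_boundary_in_disk[of 1 t] by simp
  have cb: "continuous_on {0..1} (\<lambda>t. F (disk_boundary t))"
    by (rule continuous_on_compose2[OF smooth_on_disk_continuous[OF S]])
      (use e in \<open>auto simp: disk_boundary_eq intro!: continuous_intros\<close>)
  have "\<kappa> g = pi * integral {0..1} (\<lambda>t. F (disk_boundary t) - F x\<^sub>0)"
    unfolding \<kappa>_def \<K>_eq_primitive[OF F] line_integral_disk_boundary using e by simp
  also have "\<dots> = pi * integral {0..1} (\<lambda>t. F (disk_boundary t)) - pi * F x\<^sub>0"
    using integral_diff[OF integrable_continuous_real[OF cb] integrable_const_ivl[of "F x\<^sub>0"]]
    by (simp add: right_diff_distrib)
  also have "pi * integral {0..1} (\<lambda>t. F (disk_boundary t)) =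
      integral disk (\<lambda>p. 2 * F p + ?D p p) / 2"
    unfolding divergence_disk_radial[OF S] by simp
  finally have \<kappa>: "\<kappa> g = integral disk (\<lambda>p. 2 * F p + ?D p p) / 2 - pi * F x\<^sub>0" .
  have iF: "F integrable_on disk"
    using integral_disk_polar(1)[OF smooth_on_disk_continuous[OF S]]
    by (rule set_lebesgue_integral_eq_integral(1))
  have "continuous_on disk (\<lambda>p. p$1 *\<^sub>R ?D p (axis 1 1) + p$2 *\<^sub>R ?D p (axis 2 1))"
    by (intro continuous_intros smooth_on_disk_continuous_on_diff_at S)
  then have "continuous_on disk (\<lambda>p. ?D p p)"
    by (rule continuous_on_eq) (rule linear_vec2[OF L, symmetric])
  from integral_disk_polar(1)[OF this] have iD: "(\<lambda>p. ?D p p) integrable_on disk"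
    by (rule set_lebesgue_integral_eq_integral(1))
  have "integral disk (\<lambda>p. 2 * F p + ?D p p) = 2 * integral disk F + integral disk (\<lambda>p. ?D p p)"
    using integral_add[OF integrable_on_mult_right[OF iF, of 2] iD] by simp
  moreover have "\<tau>\<^sub>0 g = - integral disk (\<lambda>p. ?D p p) / 2"
    unfolding \<tau>0 by (subst integral_mult_right) simp
  ultimately show ?thesis unfolding \<tau>'_def \<kappa> by (simp add: field_simps)
qed

section \<open>Area preservation, composition and the cocycle\<close>

lemma integral_disk_compose_Symp:
  fixes f :: "real^2 \<Rightarrow> real"
  assumes h: "h \<in> Symp_disk" and f: "continuous_on disk f"
  shows "integral disk (\<lambda>p. f (h p)) = integral disk f"
proof -
  let ?f = "\<lambda>p. vec (f p) :: real^1"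
  have "?f absolutely_integrable_on h ` disk"
    unfolding Symp_disk_image[OF h] absolutely_integrable_on_1_iff
    using integral_disk_polar(1)[OF f] by simp
  then have "integral (h ` disk) ?f = integral disk (\<lambda>p. \<bar>det (matrix (diff_at h p))\<bar> *\<^sub>R ?f (h p))"
    by (intro integral_change_of_variables smooth_on_disk_has_derivative Symp_disk_smooth
        Symp_disk_inj h disjI1) (simp_all add: disk_eq_cball)
  also have "\<dots> = integral disk (\<lambda>p. ?f (h p))"
  proof (rule integral_cong)
    fix p assume "p \<in> disk"
    from Symp_disk_det[OF h this, of "axis 1 1" "axis 2 1"]
    have "det (matrix (diff_at h p)) = 1"
      by (simp add: det_2 matrix_def axis_def)
    then show "\<bar>det (matrix (diff_at h p))\<bar> *\<^sub>R ?f (h p) = ?f (h p)" by simp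
  qed
  finally show ?thesis
    unfolding Symp_disk_image[OF h] integral_on_1_eq[of disk] by (simp add: vec_eq_iff)
qed

text \<open>Pullback is functorial: \<eta> minus its pullback by the composite is \<eta> minus its
  pullback by \<open>h\<close>, plus the pullback by \<open>h\<close> of \<eta> minus its pullback
  by \<open>g\<close>.\<close>

lemma primitive_compose:
  assumes g: "g \<in> Symp_disk" and h: "h \<in> Symp_disk" and F: "primitive g F" and G: "primitive h G"
  shows "primitive (compose disk g h) (\<lambda>p. G p + F (h p))"
  unfolding primitive_def
proof (intro conjI ballI)
  show "smooth_on disk (\<lambda>p. G p + F (h p))"
  proof (rule smooth_on_add)
    show "smooth_on disk G" using G by (simp add: primitive_def)
    show "smooth_on disk (\<lambda>p. F (h p))"
      by (rule smooth_on_compose[of disk F, OF _ Symp_disk_smooth[OF h]])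
        (use F in \<open>simp_all add: primitive_def Symp_disk_image[OF h]\<close>)
  qed
  fix p assume p: "p \<in> disk"
  then have hp: "h p \<in> disk" using Symp_disk_image[OF h] by auto
  have dh: "(h has_derivative diff_at h p) (at p within disk)"
    by (rule smooth_on_disk_has_derivative[OF Symp_disk_smooth[OF h] p])
  \<comment> \<open>As \<open>h\<close> maps the disk onto itself, derivatives within the disk
    compose at boundary points too.\<close>
  have chain: "((\<lambda>p. k (h p)) has_derivative (\<lambda>v. k' (diff_at h p v))) (at p within disk)"
    if "(k has_derivative k') (at (h p) within disk)" for k :: "real^2 \<Rightarrow> 'c::real_normed_vector" and k'
    using has_derivative_in_compose[OF dh, of k k'] that by (simp add: Symp_disk_image[OF h])
  have "((\<lambda>p. g (h p)) has_derivative (\<lambda>v. diff_at g (h p) (diff_at h p v))) (at p within disk)"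
    by (rule chain[OF smooth_on_disk_has_derivative[OF Symp_disk_smooth[OF g] hp]])
  then have "(compose disk g h has_derivative (\<lambda>v. diff_at g (h p) (diff_at h p v))) (at p within disk)"
    by (rule has_derivative_transform[OF p, rotated]) (simp add: compose_def)
  then have "diff_at (compose disk g h) p = (\<lambda>v. diff_at g (h p) (diff_at h p v))"
    using p by (rule diff_at_eqI)
  then have eq: "form1_diff \<eta> (pullback1 (compose disk g h) \<eta>) p =
      (\<lambda>v. form1_diff \<eta> (pullback1 h \<eta>) p v + form1_diff \<eta> (pullback1 g \<eta>) (h p) (diff_at h p v))"
    using p by (simp add: fun_eq_iff form1_diff_def pullback1_def compose_def)
  show "((\<lambda>p. G p + F (h p)) has_derivative form1_diff \<eta> (pullback1 (compose disk g h) \<eta>) p) (at p within disk)"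
    unfolding eq using F G p hp
    by (intro has_derivative_add chain) (simp_all add: primitive_def)
qed

text \<open>The cocycle integrates minus the differential of \<open>F\<close>, which gives the same
  value on every path in the disk.\<close>

lemma ILM_eq_primitive:
  assumes F: "primitive g F" and hx: "h x\<^sub>0 \<in> disk"
  shows "ILM \<eta> x\<^sub>0 g h = F x\<^sub>0 - F (h x\<^sub>0)"
  unfolding ILM_def
proof (rule the_equality)
  let ?a = "form1_diff (pullback1 g \<eta>) \<eta>"
  have *: "has_line_integral ?a \<gamma> (F x\<^sub>0 - F (h x\<^sub>0))"
    if \<gamma>: "valid_path \<gamma>" "path_image \<gamma> \<subseteq> disk" "pathstart \<gamma> = x\<^sub>0" "pathfinish \<gamma> = h x\<^sub>0" for \<gamma>
  proof -
    obtain S where S: "finite S" "\<gamma> C1_differentiable_on {0..1} - S" and c: "continuous_on {0..1} \<gamma>"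
      using \<gamma>(1) by (auto simp: valid_path_def piecewise_C1_differentiable_on_def)
    have sub: "\<gamma> ` {0..1} \<subseteq> disk" using \<gamma>(2) by (simp add: path_image_def)
    \<comment> \<open>\<open>- F\<close> is a primitive of \<open>?a\<close>; this form of the
      fundamental theorem tolerates the finitely many parameters in \<open>S\<close> where the path
      may fail to be differentiable.\<close>
    have "((\<lambda>t. ?a (\<gamma> t) (vector_derivative \<gamma> (at t within {0..1}))) has_integral
        (- F (\<gamma> 1)) - (- F (\<gamma> 0))) {0..1}"
    proof (rule fundamental_theorem_of_calculus_interior_strong[OF S(1)])
      fix t :: real assume t: "t \<in> {0<..<1} - S"
      have \<gamma>t: "\<gamma> t \<in> disk" using sub t by auto
      have "\<gamma> differentiable at t" using S(2) t by (simp add: C1_differentiable_on_eq)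
      then have "(\<gamma> has_vector_derivative vector_derivative \<gamma> (at t)) (at t)"
        by (simp add: vector_derivative_works)
      moreover have at: "at t within {0..1} = at t"
        using t by (intro at_within_interior) simp
      ultimately have d: "(\<gamma> has_derivative (\<lambda>s. s *\<^sub>R vector_derivative \<gamma> (at t))) (at t within {0..1})"
        by (simp add: has_vector_derivative_def)
      let ?b = "form1_diff \<eta> (pullback1 g \<eta>) (\<gamma> t)"
      have b: "(F has_derivative ?b) (at (\<gamma> t) within disk)"
        using F \<gamma>t by (simp add: primitive_def)
      have "((\<lambda>t. F (\<gamma> t)) has_derivative (\<lambda>s. ?b (s *\<^sub>R vector_derivative \<gamma> (at t)))) (at t within {0..1})"
        by (rule has_derivative_in_compose[OF d has_derivative_subset[OF b sub]])
      then have "((\<lambda>t. F (\<gamma> t)) has_vector_derivative ?b (vector_derivative \<gamma> (at t))) (at t)"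
        unfolding has_vector_derivative_def at linear_cmul[OF has_derivative_linear[OF b]] .
      from has_vector_derivative_minus[OF this]
      show "((\<lambda>t. - F (\<gamma> t)) has_vector_derivative
          ?a (\<gamma> t) (vector_derivative \<gamma> (at t within {0..1}))) (at t)"
        unfolding at by (simp add: form1_diff_def)
    next
      have "continuous_on disk F"
        using F by (simp add: primitive_def smooth_on_disk_continuous)
      then show "continuous_on {0..1} (\<lambda>t. - F (\<gamma> t))"
        by (intro continuous_on_minus continuous_on_compose2[OF _ c sub])
    qed simp
    then show ?thesis
      using \<gamma>(3,4) by (simp add: has_line_integral_def pathstart_def pathfinish_def)
  qed
  then show "\<forall>\<gamma>. valid_path \<gamma> \<and> path_image \<gamma> \<subseteq> disk \<and> pathstart \<gamma> = x\<^sub>0 \<and> pathfinish \<gamma> = h x\<^sub>0 \<longrightarrow>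
      has_line_integral ?a \<gamma> (F x\<^sub>0 - F (h x\<^sub>0))" by blast
  fix c assume c: "\<forall>\<gamma>. valid_path \<gamma> \<and> path_image \<gamma> \<subseteq> disk \<and> pathstart \<gamma> = x\<^sub>0 \<and> pathfinish \<gamma> = h x\<^sub>0 \<longrightarrow>
      has_line_integral ?a \<gamma> c"
  \<comment> \<open>By convexity the segment is an admissible path, so the condition on
    \<open>c\<close> is not vacuous and determines it.\<close>
  have l: "valid_path (linepath x\<^sub>0 (h x\<^sub>0))" "path_image (linepath x\<^sub>0 (h x\<^sub>0)) \<subseteq> disk"
    "pathstart (linepath x\<^sub>0 (h x\<^sub>0)) = x\<^sub>0" "pathfinish (linepath x\<^sub>0 (h x\<^sub>0)) = h x\<^sub>0"
    using closed_segment_subset[OF x0_in_disk hx convex_disk] by simp_all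
  show "c = F x\<^sub>0 - F (h x\<^sub>0)"
    using *[OF l] c l unfolding has_line_integral_def by (blast intro: has_integral_unique)
qed

theorem proposition5p3:
  shows "\<forall>g\<in>Symp_disk. \<forall>h\<in>Symp_disk. - coboundary \<tau>' g h = pi * ILM \<eta> x\<^sub>0 g h"
proof (intro ballI)
  fix g h assume g: "g \<in> Symp_disk" and h: "h \<in> Symp_disk"
  obtain F where F: "primitive g F" using Symp_disk_primitive[OF g] unfolding primitive_def by metis
  obtain G where G: "primitive h G" using Symp_disk_primitive[OF h] unfolding primitive_def by metis
  have cF: "continuous_on disk F" and cG: "continuous_on disk G" and ch: "continuous_on disk h"
    using F G Symp_disk_smooth[OF h] by (simp_all add: primitive_def smooth_on_disk_continuous)
  have cFh: "continuous_on disk (\<lambda>p. F (h p))"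
    by (rule continuous_on_compose2[OF cF ch]) (simp add: Symp_disk_image[OF h])
  have int: "f integrable_on disk" if "continuous_on disk f" for f :: "real^2 \<Rightarrow> real"
    using integral_disk_polar(1)[OF that] by (rule set_lebesgue_integral_eq_integral(1))
  have "\<tau>' (compose disk g h) = integral disk (\<lambda>p. G p + F (h p)) - pi * (G x\<^sub>0 + F (h x\<^sub>0))"
    by (rule \<tau>'_eq_primitive[OF primitive_compose[OF g h F G]])
  also have "integral disk (\<lambda>p. G p + F (h p)) = integral disk G + integral disk F"
    using integral_add[OF int[OF cG] int[OF cFh]] integral_disk_compose_Symp[OF h cF] by simp
  \<comment> \<open>The disk integrals cancel, and so do the terms \<open>pi * G x\<^sub>0\<close>;
    only the values of \<open>F\<close> at \<open>h x\<^sub>0\<close> and \<open>x\<^sub>0\<close>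
    remain.\<close>
  finally have "coboundary \<tau>' g h = pi * (F (h x\<^sub>0) - F x\<^sub>0)"
    unfolding coboundary_def \<tau>'_eq_primitive[OF F] \<tau>'_eq_primitive[OF G] by (simp add: algebra_simps)
  moreover have "h x\<^sub>0 \<in> disk" using Symp_disk_image[OF h] x0_in_disk by blast
  ultimately show "- coboundary \<tau>' g h = pi * ILM \<eta> x\<^sub>0 g h"
    by (simp add: ILM_eq_primitive[OF F] algebra_simps)
qed

end
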